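(* For each $n\in\mathbb{N}^\ast$, let $\mathcal{M}_n$ be the symmetric integer matrix $\mathcal{M}_n=\big(M(\lfloor n/(ij)\rfloor)\big)_{i,j\in\mathcal{S}_n}$. If $\|\mathcal{M}_n\| = O(n^{1/2+\epsilon})$ as $n\to\infty$ for every $\epsilon>0$, then the Riemann hypothesis is true.
   Context: For $n\in\mathbb{N}^\ast$, define the equivalence relation $\mathcal{R}$ on $\mathbb{N}^\ast$ by $i\,\mathcal{R}\,j \iff \lfloor n/i\rfloor=\lfloor n/j\rfloor$. Its classes are intervals; the integers $>n$ form a single unbounded class, and the other classes are finite subsets of $\{1,\dots,n\}$. Let $\mathcal{S}_n$ be the set of largest elements of the bounded classes; rows and columns of matrices indexed by $\mathcal{S}_n$ are ordered increasingly. $M(x)=\sum_{1\le m\le x}\mu(m)$ is the Mertens function, where $\mu$ is the Möbius function. $\|\cdot\|$ denotes the quadratic (spectral, operator $2$-) norm of a matrix. *)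

theory Defs
  imports
    "HOL-Complex_Analysis.Complex_Analysis"
    "HOL-Computational_Algebra.Squarefree"
    "HOL-Library.Landau_Symbols"
    "Jordan_Normal_Form.Matrix"
begin

definition moebius :: "nat \<Rightarrow> int" where
  "moebius m = (if squarefree m then (- 1) ^ card (prime_factors m) else 0)"

definition mertens :: "real \<Rightarrow> int" where
  "mertens x = (\<Sum>m \<in> {m::nat. 1 \<le> m \<and> real m \<le> x}. moebius m)"

definition floor_rel :: "nat \<Rightarrow> (nat \<times> nat) set" where
  "floor_rel n = {(i, j). 1 \<le> i \<and> 1 \<le> j \<and> \<lfloor>real n / real i\<rfloor> = \<lfloor>real n / real j\<rfloor>}"

definition index_set :: "nat \<Rightarrow> nat set" where
  "index_set n = Max ` {C \<in> {1..} // floor_rel n. bdd_above C}"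

text \<open>Row and column number \<open>k\<close> (counted from 0) of the matrix belongs to the \<open>k\<close>-th smallest
  element of the index set.\<close>

definition mertens_matrix :: "nat \<Rightarrow> int mat" where
  "mertens_matrix n =
     Matrix.mat (card (index_set n)) (card (index_set n))
       (\<lambda>(k, l). let i = sorted_list_of_set (index_set n) ! k; j = sorted_list_of_set (index_set n) ! l
                 in mertens (of_int \<lfloor>real n / (real i * real j)\<rfloor>))"

definition euclidean_norm :: "real Matrix.vec \<Rightarrow> real" where
  "euclidean_norm v = sqrt (scalar_prod v v)"

definition spectral_norm :: "real mat \<Rightarrow> real" where
  "spectral_norm A =
     Sup {euclidean_norm (mult_mat_vec A v) | v.
            v \<in> carrier_vec (dim_col A) \<and> euclidean_norm v \<le> 1}"

text \<open>The analytic continuation of the Dirichlet series to the plane without the pole 1. The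
  value at the pole is fixed arbitrarily, which makes the description unique.\<close>

definition riemann_zeta :: "complex \<Rightarrow> complex" where
  "riemann_zeta =
     (THE f. f holomorphic_on (- {1}) \<and>
             (\<forall>s. 1 < Re s \<longrightarrow> (\<lambda>n. 1 / of_nat (Suc n) powr s) sums f s) \<and>
             f 1 = 0)"

definition riemann_hypothesis :: bool where
  "riemann_hypothesis \<longleftrightarrow>
     (\<forall>s. s \<noteq> 1 \<longrightarrow> riemann_zeta s = 0 \<longrightarrow>
          (\<exists>k::nat. s = - 2 * of_nat (Suc k)) \<or> Re s = 1 / 2)"

end

(*
The class of 1 for the relation is {1}, so 1 is the smallest element of the index set and M(n) is
the first entry of the matrix; hence |M(n)| is at most the spectral norm and M(n) = O(n^(1/2+eps)).
By Abel summation the Dirichlet series of the Moebius function then continues holomorphically to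
Re s > 1/2, and its product with zeta is 1 there, so zeta has no zero with Re s > 1/2. The functional
equation reflects this to the left half of the plane, where only the zeros of sin(pi s / 2) remain.

The continuation of zeta and its functional equation come from the Mellin transform of 1/(e^x - 1).
With phi(x) = 1/(e^x - 1) - 1/x + 1/2 = sum over n >= 1 of 2x/(x^2 + 4 pi^2 n^2), the integral of
phi(x) x^(s-1) over (0, oo) equals Gamma(s) zeta(s) for -1 < s < 0 by splitting at x = 1, while
termwise integration turns it into (2 pi)^(s-1) pi / cos(pi s / 2) zeta(1-s). All series have
nonnegative terms for real s, and the identity theorem transports the identities from real s.
*)
theory Submission
  imports Defs
begin

text \<open>The series for zeta(s) and for zeta(1-s) have no common half-plane of absolute
  convergence, so the two Mellin computations live on disjoint ranges, s > 1 and -1 < s < 0. The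
  second range is forced: phi tends to 1/2 at infinity and vanishes linearly at 0. What joins them
  is the cut at x = 1. The difference 1/x - 1/2 between the two integrands, integrated against
  x^(s-1) over (0, 1] for s > 1, or subtracted over (1, oo) for s < 0, gives the same rational
  function 1/(s-1) - 1/(2s). Both transforms are thus values of one expression, whose remaining
  integrals converge for every s > -1. On the Moebius side, absolute convergence stops at Re s = 1.
  Abel summation replaces mu(n) by M(n), and the differences n^(-s) - (n+1)^(-s) gain the factor 1/n
  that pays for the size of M(n). The value of zeta at 1 is a convention, so reflection says nothing
  at s = 0; there the value -1/2 is computed directly.\<close>

section \<open>Entries of a matrix and its spectral norm\<close>

lemma abs_index_le_euclidean_norm:
  assumes "i < dim_vec v"
  shows "\<bar>vec_index v i\<bar> \<le> euclidean_norm v"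
proof -
  have "(vec_index v i)\<^sup>2 \<le> (\<Sum>k\<in>{0..<dim_vec v}. vec_index v k * vec_index v k)"
    unfolding power2_eq_square using assms
    by (intro member_le_sum[where f = "\<lambda>k. vec_index v k * vec_index v k"]) auto
  then show ?thesis
    unfolding euclidean_norm_def scalar_prod_def by (intro real_le_rsqrt) auto
qed

lemma euclidean_norm_le_sum: "euclidean_norm v \<le> (\<Sum>i<dim_vec v. \<bar>vec_index v i\<bar>)"
proof -
  have "(\<Sum>i<dim_vec v. (vec_index v i)\<^sup>2) \<le> (\<Sum>i<dim_vec v. \<bar>vec_index v i\<bar>)\<^sup>2"
    using L2_set_le_sum[of "{..<dim_vec v}" "\<lambda>i. \<bar>vec_index v i\<bar>"]
    by (metis (mono_tags, lifting) L2_set_def abs_ge_zero power2_abs sum.cong sqrt_le_D)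
  then show ?thesis
    unfolding euclidean_norm_def scalar_prod_def
    by (intro real_le_lsqrt) (auto simp: power2_eq_square lessThan_atLeast0 intro!: sum_nonneg)
qed

text \<open>\<open>Sup\<close> on the reals is informative only for bounded sets. On the unit ball
  every coordinate is at most 1 in absolute value, so the sum of the absolute entries bounds all
  images.\<close>

lemma bdd_above_spectral_norm:
  "bdd_above {euclidean_norm (mult_mat_vec A v) | v.
     v \<in> carrier_vec (dim_col A) \<and> euclidean_norm v \<le> 1}"
proof (rule bdd_aboveI)
  fix x assume "x \<in> {euclidean_norm (mult_mat_vec A v) | v.
     v \<in> carrier_vec (dim_col A) \<and> euclidean_norm v \<le> 1}"
  then obtain v where x: "x = euclidean_norm (mult_mat_vec A v)"
    and v: "v \<in> carrier_vec (dim_col A)" "euclidean_norm v \<le> 1" by auto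
  have "x \<le> (\<Sum>i<dim_row A. \<bar>vec_index (mult_mat_vec A v) i\<bar>)"
    using euclidean_norm_le_sum[of "mult_mat_vec A v"] x by simp
  also have "\<dots> \<le> (\<Sum>i<dim_row A. \<Sum>j\<in>{0..<dim_col A}. \<bar>index_mat A (i, j)\<bar>)"
  proof (rule sum_mono)
    fix i assume i: "i \<in> {..<dim_row A}"
    have "\<bar>vec_index (mult_mat_vec A v) i\<bar> = \<bar>\<Sum>j\<in>{0..<dim_col A}. index_mat A (i, j) * vec_index v j\<bar>"
      using i v by (auto simp: scalar_prod_def intro!: arg_cong[where f = abs] sum.cong)
    also have "\<dots> \<le> (\<Sum>j\<in>{0..<dim_col A}. \<bar>index_mat A (i, j)\<bar> * \<bar>vec_index v j\<bar>)"
      by (rule order_trans[OF sum_abs]) (simp add: abs_mult)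
    also have "\<dots> \<le> (\<Sum>j\<in>{0..<dim_col A}. \<bar>index_mat A (i, j)\<bar>)"
    proof (rule sum_mono)
      fix j assume "j \<in> {0..<dim_col A}"
      then have "\<bar>vec_index v j\<bar> \<le> 1"
        using abs_index_le_euclidean_norm[of j v] v by auto
      then show "\<bar>index_mat A (i, j)\<bar> * \<bar>vec_index v j\<bar> \<le> \<bar>index_mat A (i, j)\<bar>"
        by (simp add: mult_left_le)
    qed
    finally show "\<bar>vec_index (mult_mat_vec A v) i\<bar> \<le> (\<Sum>j\<in>{0..<dim_col A}. \<bar>index_mat A (i, j)\<bar>)" .
  qed
  finally show "x \<le> (\<Sum>i<dim_row A. \<Sum>j\<in>{0..<dim_col A}. \<bar>index_mat A (i, j)\<bar>)" .
qed

text \<open>The matrix sends the j-th unit vector to column j, and a coordinate never exceeds the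
  norm.\<close>

lemma entry_le_spectral_norm:
  assumes "i < dim_row A" "j < dim_col A"
  shows "\<bar>index_mat A (i, j)\<bar> \<le> spectral_norm A"
proof -
  let ?e = "unit_vec (dim_col A) j :: real Matrix.vec"
  have e: "?e \<in> carrier_vec (dim_col A)" "euclidean_norm ?e \<le> 1"
    using assms by (simp_all add: euclidean_norm_def)
  have "index_mat A (i, j) = vec_index (mult_mat_vec A ?e) i"
    using assms by simp
  then have "\<bar>index_mat A (i, j)\<bar> \<le> euclidean_norm (mult_mat_vec A ?e)"
    using abs_index_le_euclidean_norm[of i "mult_mat_vec A ?e"] assms by simp
  also have "\<dots> \<le> spectral_norm A"
    unfolding spectral_norm_def by (rule cSup_upper[OF _ bdd_above_spectral_norm]) (use e in blast)
  finally show ?thesis .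
qed

section \<open>The index set and the corner entry of the matrix\<close>

lemma equiv_floor_rel: "equiv {1..} (floor_rel n)"
  by (auto simp: equiv_def refl_on_def sym_def trans_def floor_rel_def)

text \<open>The maximum of a finite class lies in the class. Were it above n, its quotient and that
  of every larger number would have floor 0, so the class would be unbounded.\<close>

lemma index_set_subset: "index_set n \<subseteq> {1..n}"
proof
  fix m assume "m \<in> index_set n"
  then obtain C where C: "C \<in> {1..} // floor_rel n" "bdd_above C" "m = Max C"
    by (auto simp: index_set_def)
  have fin: "finite C" using C(2) by (auto simp: bdd_above_nat)
  have ne: "C \<noteq> {}" using C(1) equiv_floor_rel in_quotient_imp_non_empty by blast
  have m: "m \<in> C" using C(3) fin ne by auto
  then have C_eq: "C = floor_rel n `` {m}"
    using C(1) equiv_floor_rel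
    by (metis Image_singleton_iff equiv_class_eq_iff quotientE)
  have m1: "1 \<le> m" using m C_eq by (auto simp: floor_rel_def)
  have "m \<le> n"
  proof (rule ccontr)
    assume "\<not> m \<le> n"
    then have "\<lfloor>real n / real x\<rfloor> = 0" if "m \<le> x" for x
      using that by (simp add: floor_eq_iff)
    then have "x \<in> C" if "m \<le> x" for x
      using m1 that unfolding C_eq floor_rel_def by simp
    then have "{m..} \<subseteq> C" by blast
    then show False using fin by (meson finite_subset infinite_Ici)
  qed
  with m1 show "m \<in> {1..n}" by simp
qed

lemma one_in_index_set:
  assumes "n \<ge> 1"
  shows "1 \<in> index_set n"
proof -
  have "j = 1" if "1 \<le> j" "\<lfloor>real n / real 1\<rfloor> = \<lfloor>real n / real j\<rfloor>" for j
  proof (rule ccontr)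
    assume "j \<noteq> 1"
    then have "real j > 1" using that by simp
    then have "real n / real j < real n" using assms by (simp add: field_simps)
    moreover have "\<lfloor>real n / real j\<rfloor> = int n" using that(2) by simp
    then have "real n \<le> real n / real j" by (simp add: floor_eq_iff)
    ultimately show False by simp
  qed
  then have cls: "floor_rel n `` {1} = {1}"
    unfolding floor_rel_def by auto
  have "floor_rel n `` {1} \<in> {1..} // floor_rel n"
    by (rule quotientI) simp
  then have "{1} \<in> {C \<in> {1..} // floor_rel n. bdd_above C}"
    unfolding cls by simp
  then show ?thesis
    unfolding index_set_def by (rule rev_image_eqI) simp
qed

lemma abs_mertens_le_spectral_norm:
  assumes "n \<ge> 1"
  shows "\<bar>real_of_int (mertens (real n))\<bar> \<le> spectral_norm (map_mat real_of_int (mertens_matrix n))"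
proof -
  let ?A = "map_mat real_of_int (mertens_matrix n)"
  have fin: "finite (index_set n)" using index_set_subset finite_subset by blast
  have pos: "0 < card (index_set n)" using one_in_index_set[OF assms] fin card_gt_0_iff by blast
  then have dims: "0 < dim_row ?A" "0 < dim_col ?A" by (auto simp: mertens_matrix_def)
  \<comment> \<open>The minimum is what \<open>sorted_list_of_set\<close> puts at position 0, so row
    and column 0 belong to i = j = 1.\<close>
  have "Min (index_set n) = 1"
    using one_in_index_set[OF assms] index_set_subset[of n] fin by (intro Min_eqI) auto
  then have hd: "sorted_list_of_set (index_set n) ! 0 = 1"
    using fin pos
    by (metis card_gt_0_iff sorted_list_of_set_nonempty nth_Cons_0)
  have "index_mat ?A (0, 0) = real_of_int (mertens (real n))"
    using pos hd by (simp add: mertens_matrix_def)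
  then show ?thesis using entry_le_spectral_norm[OF dims] by simp
qed

section \<open>Holomorphic parameter integrals and series\<close>

text \<open>Discs of radius r/4 about points of the small ball stay in the large one, so Cauchy's
  inequality bounds the derivative there; the mean value inequality on the convex ball then bounds
  the quotient, uniformly in w.\<close>

lemma difference_quotient_bound:
  assumes "f holomorphic_on ball z r" "\<And>w. w \<in> ball z r \<Longrightarrow> norm (f w) \<le> B"
      and "w \<in> ball z (r / 4)" "w \<noteq> z"
  shows "norm ((f w - f z) / (w - z)) \<le> 4 / r * B"
proof -
  have r: "r > 0"
    using assms(3) zero_le_dist[of z w] unfolding mem_ball by linarith
  have deriv: "norm (deriv f u) \<le> 4 / r * B" if u: "u \<in> ball z (r / 4)" for u
  proof -
    have sub: "cball u (r / 4) \<subseteq> ball z r"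
    proof
      fix y assume "y \<in> cball u (r / 4)"
      with u r show "y \<in> ball z r" using dist_triangle[of z y u] by auto
    qed
    have "norm ((deriv ^^ 1) f u) \<le> fact 1 * B / (r / 4) ^ 1"
    proof (rule Cauchy_inequality)
      show "f holomorphic_on ball u (r / 4)"
        using assms(1) sub ball_subset_cball holomorphic_on_subset by blast
      show "continuous_on (cball u (r / 4)) f"
        using assms(1) sub holomorphic_on_imp_continuous_on continuous_on_subset by blast
      show "norm (f x) \<le> B" if "norm (u - x) = r / 4" for x
        using assms(2) sub that by (auto simp: dist_norm)
    qed (use r in auto)
    then show ?thesis by (simp add: mult.commute)
  qed
  have "norm (f w - f z) \<le> 4 / r * B * norm (w - z)"
  proof (rule field_differentiable_bound[where S = "ball z (r / 4)" and f' = "deriv f"])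
    fix u assume u: "u \<in> ball z (r / 4)"
    then have "u \<in> ball z r" using r by auto
    then show "(f has_field_derivative deriv f u) (at u within ball z (r / 4))"
      using holomorphic_derivI[OF assms(1) open_ball] by blast
  qed (use deriv assms r in auto)
  then show ?thesis using assms(4) by (simp add: norm_divide field_simps)
qed

text \<open>Differentiation under the integral sign. A majorant of the integrand alone is enough,
  since for holomorphic integrands it also majorizes the difference quotients up to a
  constant.\<close>

lemma holomorphic_on_integral:
  fixes G :: "complex \<Rightarrow> 'a \<Rightarrow> complex"
  assumes U: "open U"
    and hol: "\<And>x. x \<in> space M \<Longrightarrow> (\<lambda>s. G s x) holomorphic_on U"
    and meas: "\<And>s. s \<in> U \<Longrightarrow> G s \<in> borel_measurable M"
    and int: "integrable M B"
    and bound: "\<And>s x. s \<in> U \<Longrightarrow> x \<in> space M \<Longrightarrow> norm (G s x) \<le> B x"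
  shows "(\<lambda>s. integral\<^sup>L M (G s)) holomorphic_on U"
proof -
  have intG: "integrable M (G s)" if "s \<in> U" for s
    by (rule Bochner_Integration.integrable_bound[OF int meas[OF that]])
      (use bound[OF that] in \<open>force intro: AE_I2\<close>)
  have "(\<lambda>s. integral\<^sup>L M (G s)) field_differentiable (at z)" if z: "z \<in> U" for z
  proof -
    obtain r where r: "r > 0" "ball z r \<subseteq> U" using U z openE by blast
    define D where "D = (\<lambda>x. deriv (\<lambda>s. G s x) z)"
    have der: "((\<lambda>w. (G w x - G z x) / (w - z)) \<longlongrightarrow> D x) (at z)" if "x \<in> space M" for x
      using holomorphic_derivI[OF hol[OF that] U z, of UNIV] unfolding has_field_derivative_iff D_def .
    have "((\<lambda>w. (integral\<^sup>L M (G w) - integral\<^sup>L M (G z)) / (w - z)) \<longlongrightarrow> integral\<^sup>L M D) (at z within ball z (r / 4))"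
      \<comment> \<open>Dominated convergence speaks of sequences, so the limit is tested along
        sequences in the disc where the quotient bound holds.\<close>
      unfolding tendsto_at_iff_sequentially comp_def
    proof (intro allI impI)
      fix X :: "nat \<Rightarrow> complex" assume X: "\<forall>i. X i \<in> ball z (r / 4) - {z}" and lim: "X \<longlonglongrightarrow> z"
      have XU: "X i \<in> U" for i using X[rule_format, of i] r by auto
      let ?q = "\<lambda>i x. (G (X i) x - G z x) / (X i - z)"
      have conv: "(\<lambda>i. ?q i x) \<longlonglongrightarrow> D x" if "x \<in> space M" for x
        using der[OF that] X lim unfolding tendsto_at_iff_sequentially comp_def by blast
      have mq: "?q i \<in> borel_measurable M" for i
        using meas[OF XU] meas[OF z] by simp
      have "(\<lambda>i. integral\<^sup>L M (?q i)) \<longlonglongrightarrow> integral\<^sup>L M D"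
      proof (rule integral_dominated_convergence[where w = "\<lambda>x. 4 / r * B x"])
        show "D \<in> borel_measurable M"
          by (rule borel_measurable_LIMSEQ_metric[OF mq conv])
        show "AE x in M. norm (?q i x) \<le> 4 / r * B x" for i
        proof (rule AE_I2, rule difference_quotient_bound)
          fix x assume x: "x \<in> space M"
          show "(\<lambda>s. G s x) holomorphic_on ball z r"
            using hol[OF x] r(2) holomorphic_on_subset by blast
          show "norm (G w x) \<le> B x" if "w \<in> ball z r" for w using bound[of w x] x r that by blast
        qed (use X in auto)
      qed (use int mq conv in auto)
      moreover have "integral\<^sup>L M (?q i) = (integral\<^sup>L M (G (X i)) - integral\<^sup>L M (G z)) / (X i - z)" for i
        using intG[OF XU] intG[OF z] by simp
      ultimately show "(\<lambda>i. (integral\<^sup>L M (G (X i)) - integral\<^sup>L M (G z)) / (X i - z)) \<longlonglongrightarrow> integral\<^sup>L M D"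
        by (simp only:)
    qed
    then have "((\<lambda>s. integral\<^sup>L M (G s)) has_field_derivative integral\<^sup>L M D) (at z within ball z (r / 4))"
      unfolding has_field_derivative_iff .
    then have "((\<lambda>s. integral\<^sup>L M (G s)) has_field_derivative integral\<^sup>L M D) (at z)"
      using at_within_open[of z "ball z (r / 4)"] r by simp
    then show ?thesis using field_differentiable_def by blast
  qed
  then show ?thesis using holomorphic_on_def field_differentiable_at_within by blast
qed

text \<open>On a whole half-plane there is often no single integrable majorant; holomorphy is local,
  so each point may bring its own neighbourhood and majorant.\<close>

lemma holomorphic_on_integral_locally:
  fixes G :: "complex \<Rightarrow> 'a \<Rightarrow> complex"
  assumes "\<And>z. z \<in> U \<Longrightarrow> \<exists>V B. open V \<and> z \<in> V \<and> integrable M B \<and>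
      (\<forall>x\<in>space M. (\<lambda>s. G s x) holomorphic_on V) \<and>
      (\<forall>s\<in>V. G s \<in> borel_measurable M \<and> (\<forall>x\<in>space M. norm (G s x) \<le> B x))"
  shows "(\<lambda>s. integral\<^sup>L M (G s)) holomorphic_on U"
proof -
  have "(\<lambda>s. integral\<^sup>L M (G s)) field_differentiable (at z)" if z: "z \<in> U" for z
  proof -
    obtain V B where V: "open V" "z \<in> V" "integrable M B" "\<forall>x\<in>space M. (\<lambda>s. G s x) holomorphic_on V"
      "\<forall>s\<in>V. G s \<in> borel_measurable M \<and> (\<forall>x\<in>space M. norm (G s x) \<le> B x)"
      using assms[OF z] by blast
    have "(\<lambda>s. integral\<^sup>L M (G s)) holomorphic_on V"
      by (rule holomorphic_on_integral[OF V(1) _ _ V(3)]) (use V in auto)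
    then show ?thesis using V(1,2) holomorphic_on_imp_differentiable_at by blast
  qed
  then show ?thesis using holomorphic_on_def field_differentiable_at_within by blast
qed

lemma norm_of_real_powr_le:
  assumes "x > 0" "a \<le> Re s" "Re s \<le> b"
  shows "norm (complex_of_real x powr s) \<le> x powr a + x powr b"
proof -
  have "norm (complex_of_real x powr s) = x powr Re s" using assms by (simp add: norm_powr_real_powr)
  also have "\<dots> \<le> x powr a + x powr b"
  proof (cases "x \<ge> 1")
    case True
    then have "x powr Re s \<le> x powr b" using assms by (simp add: powr_mono)
    then show ?thesis by (simp add: add_increasing)
  next
    case False
    then have "x powr Re s \<le> x powr a" using assms by (intro powr_mono') auto
    then show ?thesis by (simp add: add_increasing2)
  qed
  finally show ?thesis .
qed

text \<open>\<open>T\<close> collects real exponents of absolute convergence. On a strip between two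
  of them, the sum of the two end integrands is a majorant, because a power lies below one end power
  for x >= 1 and below the other for x < 1.\<close>

lemma holomorphic_on_mellin:
  fixes g :: "real \<Rightarrow> real"
  assumes meas: "set_borel_measurable lborel S g" and S: "S \<in> sets borel" "S \<subseteq> {0<..}"
    and int: "\<And>s. s \<in> T \<Longrightarrow> set_integrable lborel S (\<lambda>x. \<bar>g x\<bar> * x powr (s - 1))"
    and U: "U = {s. \<exists>a\<in>T. \<exists>b\<in>T. a < Re s \<and> Re s < b}"
  shows "(\<lambda>s. LINT x:S|lborel. of_real (g x) * of_real x powr (s - 1) :: complex) holomorphic_on U"
  unfolding set_lebesgue_integral_def
proof (rule holomorphic_on_integral_locally)
  fix z assume "z \<in> U"
  then obtain a b where ab: "a \<in> T" "b \<in> T" "a < Re z" "Re z < b" unfolding U by auto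
  let ?V = "{s. a < Re s} \<inter> {s. Re s < b}"
  let ?B = "\<lambda>x. indicator S x *\<^sub>R (\<bar>g x\<bar> * x powr (a - 1)) + indicator S x *\<^sub>R (\<bar>g x\<bar> * x powr (b - 1))"
  let ?G = "\<lambda>s x. indicator S x *\<^sub>R (of_real (g x) * of_real x powr (s - 1) :: complex)"
  have "open ?V" by (intro open_Int open_halfspace_Re_gt open_halfspace_Re_lt)
  moreover have "z \<in> ?V" using ab by simp
  moreover have "integrable lborel ?B"
    using int[OF ab(1)] int[OF ab(2)] unfolding set_integrable_def by (rule Bochner_Integration.integrable_add)
  moreover have "(\<lambda>s. ?G s x) holomorphic_on ?V" for x
    by (cases "x \<in> S") (use S in \<open>auto intro!: holomorphic_intros\<close>)
  moreover have "?G s \<in> borel_measurable lborel" for s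
  proof -
    have "(\<lambda>x. indicator S x *\<^sub>R g x) \<in> borel_measurable borel"
      using meas unfolding set_borel_measurable_def by simp
    then have "(\<lambda>x. of_real (indicator S x *\<^sub>R g x) * of_real x powr (s - 1) :: complex) \<in> borel_measurable borel"
      by measurable
    then show ?thesis by (simp add: scaleR_conv_of_real mult.assoc)
  qed
  moreover have "norm (?G s x) \<le> ?B x" if "s \<in> ?V" for s x
  proof (cases "x \<in> S")
    case True
    have "norm (of_real x powr (s - 1) :: complex) \<le> x powr (a - 1) + x powr (b - 1)"
      by (rule norm_of_real_powr_le) (use True S that in auto)
    then have "\<bar>g x\<bar> * norm (of_real x powr (s - 1) :: complex) \<le> \<bar>g x\<bar> * (x powr (a - 1) + x powr (b - 1))"
      by (rule mult_left_mono) simp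
    then show ?thesis using True by (simp add: norm_mult distrib_left)
  qed simp
  ultimately show "\<exists>V B. open V \<and> z \<in> V \<and> integrable lborel B \<and>
      (\<forall>x\<in>space lborel. (\<lambda>s. ?G s x) holomorphic_on V) \<and>
      (\<forall>s\<in>V. ?G s \<in> borel_measurable lborel \<and> (\<forall>x\<in>space lborel. norm (?G s x) \<le> B x))"
    by blast
qed

text \<open>A series is an integral over the counting measure, so the result on parameter integrals
  becomes the Weierstrass test.\<close>

lemma holomorphic_on_suminf_locally:
  fixes G :: "complex \<Rightarrow> nat \<Rightarrow> complex"
  assumes "\<And>z. z \<in> U \<Longrightarrow> \<exists>V B. open V \<and> z \<in> V \<and> summable B \<and>
      (\<forall>n. (\<lambda>s. G s n) holomorphic_on V) \<and> (\<forall>s\<in>V. \<forall>n. norm (G s n) \<le> B n)"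
  shows "(\<lambda>s. \<Sum>n. G s n) holomorphic_on U"
proof -
  have int: "integral\<^sup>L (count_space UNIV) (G s) = (\<Sum>n. G s n)" if s: "s \<in> U" for s
  proof (rule integral_count_space_nat)
    obtain V B where "s \<in> V" and B: "summable B" "\<forall>s\<in>V. \<forall>n. norm (G s n) \<le> B n"
      using assms[OF s] by blast
    then have "summable (\<lambda>n. norm (G s n))"
      by (intro summable_comparison_test'[OF B(1)]) auto
    then show "integrable (count_space UNIV) (G s)"
      by (simp add: integrable_count_space_nat_iff)
  qed
  have "(\<lambda>s. integral\<^sup>L (count_space UNIV) (G s)) holomorphic_on U"
  proof (rule holomorphic_on_integral_locally)
    fix z assume z: "z \<in> U"
    obtain V B where V: "open V" "z \<in> V" "summable B" "\<forall>n. (\<lambda>s. G s n) holomorphic_on V"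
      "\<forall>s\<in>V. \<forall>n. norm (G s n) \<le> B n"
      using assms[OF z] by blast
    \<comment> \<open>Dominating the norms at z makes \<open>B\<close> nonnegative, so its
      summability is absolute, as integrability demands.\<close>
    have "norm (B n) = B n" for n
      using V(2,5) norm_ge_zero order_trans by (metis abs_of_nonneg real_norm_def)
    then have "integrable (count_space UNIV) B"
      using V(3) by (simp add: integrable_count_space_nat_iff)
    with V show "\<exists>V B. open V \<and> z \<in> V \<and> integrable (count_space UNIV) B \<and>
        (\<forall>x\<in>space (count_space UNIV). (\<lambda>s. G s x) holomorphic_on V) \<and>
        (\<forall>s\<in>V. G s \<in> borel_measurable (count_space UNIV) \<and> (\<forall>x\<in>space (count_space UNIV). norm (G s x) \<le> B x))"
      by (intro exI[of _ V] exI[of _ B]) simp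
  qed
  then show ?thesis by (rule holomorphic_transform) (rule int)
qed

lemma holomorphic_eq_if_eq_on_reals:
  fixes f g :: "complex \<Rightarrow> complex"
  assumes hol: "f holomorphic_on S" "g holomorphic_on S" and S: "open S" "connected S"
    and ab: "a < b" and sub: "\<And>x. a < x \<Longrightarrow> x < b \<Longrightarrow> of_real x \<in> S"
    and eq: "\<And>x. a < x \<Longrightarrow> x < b \<Longrightarrow> f (of_real x) = g (of_real x)"
    and w: "w \<in> S"
  shows "f w = g w"
proof -
  let ?m = "(a + b) / 2"
  have "complex_of_real ?m islimpt of_real ` {a<..<b}"
    unfolding islimpt_approachable
  proof (intro allI impI)
    fix e :: real assume e: "e > 0"
    \<comment> \<open>A point to the right of the midpoint, closer to it than e and still below
      b.\<close>
    define x where "x = ?m + min e (b - ?m) / 2"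
    have "?m < x" "x < b" "x - ?m < e" using e ab by (auto simp: x_def min_def field_simps)
    moreover have "dist (complex_of_real x) (complex_of_real ?m) = \<bar>x - ?m\<bar>"
      by (simp only: dist_of_real dist_real_def)
    ultimately show "\<exists>x'\<in>of_real ` {a<..<b}. x' \<noteq> complex_of_real ?m \<and> dist x' (complex_of_real ?m) < e"
      using ab by (intro bexI[of _ "of_real x"]) (auto simp only: of_real_eq_iff, auto)
  qed
  then have "f w - g w = 0"
  proof (rule analytic_continuation[where f = "\<lambda>s. f s - g s", OF _ S, rotated 3])
    show "(\<lambda>s. f s - g s) holomorphic_on S" using hol by (intro holomorphic_intros)
    show "of_real ?m \<in> S" using ab by (intro sub) auto
  qed (use sub eq w in auto)
  then show ?thesis by simp
qed

section \<open>Partial fractions of the cotangent\<close>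

text \<open>Differentiate the reflection formula in the form rGamma(z) rGamma(1-z) = sin(pi z)/pi,
  whose factors are entire, and divide by it.\<close>

lemma Digamma_reflection:
  assumes "z \<notin> (\<int> :: complex set)"
  shows "Digamma (1 - z) - Digamma z = of_real pi * cot (of_real pi * z)"
proof -
  have "1 - z \<notin> \<int>"
    using assms Ints_diff[of 1 "1 - z"] by auto
  then have nz: "z \<notin> \<int>\<^sub>\<le>\<^sub>0" "1 - z \<notin> \<int>\<^sub>\<le>\<^sub>0"
    using assms nonpos_Ints_subset_Ints by blast+
  have eq: "(\<lambda>w. rGamma w * rGamma (1 - w)) = (\<lambda>w. sin (of_real pi * w) / (of_real pi :: complex))"
    using rGamma_reflection_complex by blast
  have "((\<lambda>w. rGamma w * rGamma (1 - w)) has_field_derivative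
      - (rGamma z * Digamma z) * rGamma (1 - z) + rGamma (1 - z) * Digamma (1 - z) * rGamma z) (at z)"
    using nz by (auto intro!: derivative_eq_intros)
  moreover have "((\<lambda>w. sin (of_real pi * w) / of_real pi) has_field_derivative cos (of_real pi * z)) (at z)"
    by (auto intro!: derivative_eq_intros)
  ultimately have "- (rGamma z * Digamma z) * rGamma (1 - z) + rGamma (1 - z) * Digamma (1 - z) * rGamma z
      = cos (of_real pi * z)"
    unfolding eq by (rule DERIV_unique)
  then have "(Digamma (1 - z) - Digamma z) * (rGamma z * rGamma (1 - z)) = cos (of_real pi * z)"
    by (simp add: algebra_simps)
  moreover have "sin (of_real pi * z) \<noteq> 0"
    using assms by (auto simp: sin_eq_0)
  ultimately show ?thesis
    unfolding rGamma_reflection_complex by (simp add: cot_def field_simps)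
qed

text \<open>In the difference of the series for Digamma(1-z) and Digamma(1+z) the harmonic terms and
  Euler's constant cancel. The shift from Digamma(1+z) to Digamma(z) produces 1/z.\<close>

lemma cot_partial_fractions:
  assumes "z \<notin> (\<int> :: complex set)"
  shows "(\<lambda>n. 2 * z / (z\<^sup>2 - of_nat (Suc n) ^ 2)) sums (of_real pi * cot (of_real pi * z) - 1 / z)"
proof -
  have z0: "z \<noteq> 0" using assms by auto
  have s1: "1 - z \<noteq> 0" "1 + z \<noteq> 0"
    using assms Ints_minus[of "- z"] by (auto simp: add_eq_0_iff)
  have "(\<lambda>k. (inverse (of_nat (Suc k)) - inverse (1 - z + of_nat k))
           - (inverse (of_nat (Suc k)) - inverse (1 + z + of_nat k)))
        sums ((Digamma (1 - z) + euler_mascheroni) - (Digamma (1 + z) + euler_mascheroni))"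
    by (intro sums_diff) (use summable_Digamma[OF s1(1)] summable_Digamma[OF s1(2)] in
      \<open>auto simp: Digamma_def intro: summable_sums\<close>)
  moreover have "(inverse (of_nat (Suc k)) - inverse (1 - z + of_nat k))
           - (inverse (of_nat (Suc k)) - inverse (1 + z + of_nat k)) = 2 * z / (z\<^sup>2 - of_nat (Suc k) ^ 2)" for k
  proof -
    have "z \<noteq> of_nat (Suc k)" "z \<noteq> - of_nat (Suc k)" using assms by auto
    then have nz: "1 - z + of_nat k \<noteq> 0" "1 + z + of_nat k \<noteq> 0"
    proof -
      have "1 - z + of_nat k = of_nat (Suc k) - z" "1 + z + of_nat k = z - (- of_nat (Suc k))"
        by simp_all
      with \<open>z \<noteq> of_nat (Suc k)\<close> \<open>z \<noteq> - of_nat (Suc k)\<close> show "1 - z + of_nat k \<noteq> 0" "1 + z + of_nat k \<noteq> 0"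
        by (metis right_minus_eq)+
    qed
    have "(inverse (of_nat (Suc k)) - inverse (1 - z + of_nat k))
           - (inverse (of_nat (Suc k)) - inverse (1 + z + of_nat k))
        = inverse (1 + z + of_nat k) - inverse (1 - z + of_nat k)"
      by simp
    also have "\<dots> = ((1 - z + of_nat k) - (1 + z + of_nat k)) / ((1 + z + of_nat k) * (1 - z + of_nat k))"
    proof -
      have "inverse a - inverse b = (b - a) / (a * b)" if "a \<noteq> 0" "b \<noteq> 0" for a b :: complex
        using that by (simp add: field_simps)
      then show ?thesis using nz by blast
    qed
    also have "(1 - z + of_nat k) - (1 + z + of_nat k) = - (2 * z)" by simp
    also have "(1 + z + of_nat k) * (1 - z + of_nat k) = - (z\<^sup>2 - of_nat (Suc k) ^ 2)"
      by (simp add: algebra_simps power2_eq_square)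
    finally show ?thesis by (simp only: minus_divide_divide)
  qed
  moreover have "Digamma (1 - z) - Digamma (1 + z) = of_real pi * cot (of_real pi * z) - 1 / z"
    using Digamma_reflection[OF assms] Digamma_plus1[OF z0] by (simp add: algebra_simps)
  ultimately show ?thesis by simp
qed

text \<open>The Bose-Einstein function: its geometric expansion in exp(-nx), n >= 1, makes its
  Mellin transform Gamma times zeta.\<close>

definition bose :: "real \<Rightarrow> real" where "bose x = 1 / (exp x - 1)"
text \<open>The principal part and the constant term of the Laurent expansion at 0 are removed, so that the
  Mellin integral over \<open>(0, 1]\<close> converges for \<open>Re s > -1\<close>.\<close>

definition bose_rem :: "real \<Rightarrow> real" where "bose_rem x = bose x - 1 / x + 1 / 2"

text \<open>Cotangent partial fractions at the imaginary point z = i x/(2 pi), scaled by i/(2 pi).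
  There i cot(i x/2) = coth(x/2) = 2 bose(x) + 1, and the term 1/z becomes 1/x.\<close>

lemma bose_rem_sums:
  assumes "x > 0"
  shows "(\<lambda>n. 2 * x / (x\<^sup>2 + (2 * pi * real (Suc n))\<^sup>2)) sums bose_rem x"
proof -
  define z where "z = \<i> * complex_of_real (x / (2 * pi))"
  have "z \<notin> \<int>" using assms by (auto simp: z_def complex_eq_iff elim!: Ints_cases)
  from cot_partial_fractions[OF this]
  have "(\<lambda>n. (\<i> / (2 * of_real pi)) * (2 * z / (z\<^sup>2 - of_nat (Suc n) ^ 2))) sums
      ((\<i> / (2 * of_real pi)) * (of_real pi * cot (of_real pi * z) - 1 / z))"
    by (rule sums_mult)
  moreover have "(\<i> / (2 * of_real pi)) * (2 * z / (z\<^sup>2 - of_nat (Suc n) ^ 2))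
      = complex_of_real (2 * x / (x\<^sup>2 + (2 * pi * real (Suc n))\<^sup>2))" for n
  proof -
    have pos: "x\<^sup>2 + (2 * pi * real (Suc n))\<^sup>2 > 0" using assms by (simp add: add_pos_nonneg)
    have d: "z\<^sup>2 - of_nat (Suc n) ^ 2 = - complex_of_real ((x\<^sup>2 + (2 * pi * real (Suc n))\<^sup>2) / (2 * pi)\<^sup>2)"
      by (simp add: z_def power_mult_distrib power_divide field_simps power2_eq_square power4_eq_xxxx)
    have n: "2 * z * (\<i> / (2 * of_real pi)) = - complex_of_real (2 * x / (2 * pi)\<^sup>2)"
      by (simp add: z_def power2_eq_square field_simps)
    have "(\<i> / (2 * of_real pi)) * (2 * z / (z\<^sup>2 - of_nat (Suc n) ^ 2)) =
       (- complex_of_real (2 * x / (2 * pi)\<^sup>2)) / (- complex_of_real ((x\<^sup>2 + (2 * pi * real (Suc n))\<^sup>2) / (2 * pi)\<^sup>2))"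
      unfolding d[symmetric] n[symmetric] by simp
    also have "\<dots> = complex_of_real ((2 * x / (2 * pi)\<^sup>2) / ((x\<^sup>2 + (2 * pi * real (Suc n))\<^sup>2) / (2 * pi)\<^sup>2))"
      by (simp only: minus_divide_divide of_real_divide)
    also have "(2 * x / (2 * pi)\<^sup>2) / ((x\<^sup>2 + (2 * pi * real (Suc n))\<^sup>2) / (2 * pi)\<^sup>2)
        = 2 * x / (x\<^sup>2 + (2 * pi * real (Suc n))\<^sup>2)" by simp
    finally show ?thesis .
  qed
  moreover have "(\<i> / (2 * of_real pi)) * (of_real pi * cot (of_real pi * z) - 1 / z) = complex_of_real (bose_rem x)"
  proof -
    have pz: "of_real pi * z = \<i> * complex_of_real (x / 2)" by (simp add: z_def)
    have "(\<i> / (2 * of_real pi)) * (of_real pi * cot (of_real pi * z)) = \<i> * cot (\<i> * complex_of_real (x / 2)) / 2"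
      unfolding pz by simp
    moreover have "\<i> * cot (\<i> * complex_of_real (x / 2)) = complex_of_real (2 * bose x + 1)"
    proof -
      define e where "e = exp (complex_of_real (x / 2))"
      have e2: "e * e = complex_of_real (exp x)"
        unfolding e_def exp_of_real by (simp flip: exp_add of_real_mult)
      have e0: "e \<noteq> 0" by (simp add: e_def)
      have ne: "e * e \<noteq> 1" unfolding e2 using assms by (simp add: complex_eq_iff)
      have "exp x \<noteq> 1" using assms by simp
      have "\<i> * cot (\<i> * complex_of_real (x / 2)) = (e + inverse e) / (e - inverse e)"
      proof -
        have ie: "\<i> * (\<i> * complex_of_real (x / 2)) = - complex_of_real (x / 2)" by simp
        have cos: "cos (\<i> * complex_of_real (x / 2)) = (inverse e + e) / 2"
          and sin: "sin (\<i> * complex_of_real (x / 2)) = (inverse e - e) / (2 * \<i>)"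
          unfolding cos_exp_eq sin_exp_eq mult_minus_left ie e_def by (simp_all add: exp_minus)
        have "\<i> * ((a / 2) / (b / (2 * \<i>))) = a / (- b)" for a b :: complex
          by (simp add: field_simps)
        then have "\<i> * cot (\<i> * complex_of_real (x / 2)) = (inverse e + e) / (- (inverse e - e))"
          unfolding cot_def cos sin .
        then show ?thesis by (simp add: add.commute)
      qed
      also have "\<dots> = (e * e + 1) / (e * e - 1)"
        using e0 ne by (simp add: divide_simps)
      also have "\<dots> = complex_of_real ((exp x + 1) / (exp x - 1))" unfolding e2 by simp
      also have "(exp x + 1) / (exp x - 1) = 2 * bose x + 1"
        using \<open>exp x \<noteq> 1\<close> by (simp add: bose_def field_simps)
      finally show ?thesis .
    qed
    moreover have "(\<i> / (2 * of_real pi)) * (1 / z) = complex_of_real (1 / x)"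
      using assms by (simp add: z_def)
    ultimately have "(\<i> / (2 * of_real pi)) * (of_real pi * cot (of_real pi * z) - 1 / z)
       = complex_of_real (2 * bose x + 1) / 2 - complex_of_real (1 / x)"
      by (simp only: right_diff_distrib)
    then show ?thesis by (simp add: bose_rem_def field_simps)
  qed
  ultimately have "(\<lambda>n. complex_of_real (2 * x / (x\<^sup>2 + (2 * pi * real (Suc n))\<^sup>2))) sums complex_of_real (bose_rem x)"
    by simp
  then show ?thesis by (simp only: sums_of_real_iff)
qed

section \<open>Mellin transforms on the real line\<close>

text \<open>Euler's integral after the substitution t = a x.\<close>

lemma nn_integral_powr_exp:
  fixes s a :: real
  assumes s: "s > 0" and a: "a > 0"
  shows "(\<integral>\<^sup>+x. ennreal (x powr (s - 1) * exp (- a * x)) * indicator {0<..} x \<partial>lborel) = ennreal (Gamma s * a powr (- s))"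
proof -
  let ?I = "\<integral>\<^sup>+x. ennreal (x powr (s - 1) * exp (- a * x)) * indicator {0<..} x \<partial>lborel"
  have "ennreal (Gamma s) = (\<integral>\<^sup>+t. ennreal (indicator {0..} t * t powr (s - 1) / exp t) \<partial>lborel)"
    using Gamma_conv_nn_integral_real[OF s] .
  also have "\<dots> = ennreal \<bar>a\<bar> * (\<integral>\<^sup>+x. ennreal (indicator {0..} (0 + a * x) * (0 + a * x) powr (s - 1) / exp (0 + a * x)) \<partial>lborel)"
    by (rule nn_integral_real_affine) (use a in auto)
  also have "\<dots> = (\<integral>\<^sup>+x. ennreal \<bar>a\<bar> * ennreal (indicator {0..} (0 + a * x) * (0 + a * x) powr (s - 1) / exp (0 + a * x)) \<partial>lborel)"
    by (rule nn_integral_cmult[symmetric]) simp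
  also have "\<dots> = (\<integral>\<^sup>+x. ennreal (a powr s) * (ennreal (x powr (s - 1) * exp (- a * x)) * indicator {0<..} x) \<partial>lborel)"
  \<comment> \<open>One integrand lives on the closed and the other on the open half-line, so they
    are compared off the null set of the point 0.\<close>
  proof (rule nn_integral_cong_AE, rule AE_I[where N = "{0}"])
    show "{x \<in> space lborel. ennreal \<bar>a\<bar> * ennreal (indicator {0..} (0 + a * x) * (0 + a * x) powr (s - 1) / exp (0 + a * x))
        \<noteq> ennreal (a powr s) * (ennreal (x powr (s - 1) * exp (- a * x)) * indicator {0<..} x)} \<subseteq> {0}"
    proof clarify
      fix x assume ne: "ennreal \<bar>a\<bar> * ennreal (indicator {0..} (0 + a * x) * (0 + a * x) powr (s - 1) / exp (0 + a * x))
        \<noteq> ennreal (a powr s) * (ennreal (x powr (s - 1) * exp (- a * x)) * indicator {0<..} x)"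
      show "x = 0"
      proof (rule ccontr)
        assume "x \<noteq> 0"
        then consider "x < 0" | "x > 0" by linarith
        then show False
        proof cases
          case 1
          then have "a * x < 0" using a by (simp add: mult_pos_neg)
          with 1 ne show False by (simp add: indicator_def)
        next
          case 2
          have "a * (a * x) powr (s - 1) = a powr s * x powr (s - 1)"
            using a 2 by (simp add: powr_mult powr_diff)
          then have "a * ((a * x) powr (s - 1) / exp (a * x)) = a powr s * (x powr (s - 1) * exp (- a * x))"
            by (simp add: exp_minus field_simps)
          with 2 a ne show False by (simp flip: ennreal_mult')
        qed
      qed
    qed
  qed auto
  also have "\<dots> = ennreal (a powr s) * ?I"
    by (rule nn_integral_cmult) simp
  finally have "ennreal (a powr (- s)) * ennreal (Gamma s) = ennreal (a powr (- s)) * (ennreal (a powr s) * ?I)"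
    by simp
  also have "\<dots> = ennreal (a powr (- s) * a powr s) * ?I"
    by (simp add: ennreal_mult' mult.assoc)
  also have "a powr (- s) * a powr s = 1" using a by (simp flip: powr_add)
  finally show ?thesis using s by (simp add: ennreal_mult' mult.commute)
qed

text \<open>Nonnegative terms allow sum and integral to be exchanged by monotone convergence; the
  finite value then yields integrability as well.\<close>

lemma has_bochner_integral_nonneg_series:
  fixes f :: "nat \<Rightarrow> real \<Rightarrow> real"
  assumes meas: "\<And>n. f n \<in> borel_measurable borel" and S: "S \<in> sets borel"
    and nonneg: "\<And>n x. x \<in> S \<Longrightarrow> 0 \<le> f n x"
    and int: "\<And>n. (\<integral>\<^sup>+x. ennreal (f n x) * indicator S x \<partial>lborel) = ennreal (c n)"
    and c: "\<And>n. 0 \<le> c n" "summable c"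
    and sums: "\<And>x. x \<in> S \<Longrightarrow> (\<lambda>n. f n x) sums F x"
  shows "has_bochner_integral lborel (\<lambda>x. indicator S x *\<^sub>R F x) (suminf c)"
proof -
  have eq: "indicator S x *\<^sub>R F x = (\<Sum>n. indicator S x * f n x)" for x
    using sums[of x] by (cases "x \<in> S") (auto simp: sums_iff)
  have meas': "(\<lambda>x. indicator S x *\<^sub>R F x) \<in> borel_measurable lborel"
    unfolding eq using meas S by measurable
  have nn: "0 \<le> indicator S x *\<^sub>R F x" for x
    unfolding eq using nonneg sums[of x] by (cases "x \<in> S") (auto intro!: suminf_nonneg dest: sums_summable)
  have "(\<integral>\<^sup>+x. ennreal (indicator S x *\<^sub>R F x) \<partial>lborel) = (\<integral>\<^sup>+x. (\<Sum>n. ennreal (f n x) * indicator S x) \<partial>lborel)"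
  proof (rule nn_integral_cong)
    fix x
    show "ennreal (indicator S x *\<^sub>R F x) = (\<Sum>n. ennreal (f n x) * indicator S x)"
    proof (cases "x \<in> S")
      case True
      have "(\<Sum>n. ennreal (f n x)) = ennreal (\<Sum>n. f n x)"
        using nonneg[OF True] sums_summable[OF sums[OF True]] by (rule suminf_ennreal2)
      also have "(\<Sum>n. f n x) = F x"
        using sums_unique[OF sums[OF True]] by simp
      finally show ?thesis using True by simp
    qed simp
  qed
  also have "\<dots> = (\<Sum>n. \<integral>\<^sup>+x. ennreal (f n x) * indicator S x \<partial>lborel)"
    by (rule nn_integral_suminf) (use meas S in measurable)
  also have "\<dots> = ennreal (suminf c)"
    unfolding int by (rule suminf_ennreal2[OF c])
  finally show ?thesis
    using meas' nn c by (intro has_bochner_integral_nn_integral) (auto intro: suminf_nonneg)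
qed

lemma exp_sums_bose:
  assumes "x > 0"
  shows "(\<lambda>n. exp (- real (Suc n) * x)) sums bose x"
proof -
  have "(\<lambda>n. exp (- x) * exp (- x) ^ n) sums (exp (- x) * (1 / (1 - exp (- x))))"
    using assms by (intro sums_mult geometric_sums) simp
  moreover have "exp (- x) * exp (- x) ^ n = exp (- real (Suc n) * x)" for n
    by (simp flip: exp_of_nat_mult exp_add) (simp add: algebra_simps)
  moreover have "exp (- x) * (1 / (1 - exp (- x))) = bose x"
    using assms by (simp add: bose_def exp_minus field_simps)
  ultimately show ?thesis by simp
qed

lemma summable_Suc_powr:
  assumes "s > 1"
  shows "summable (\<lambda>n. real (Suc n) powr (- s))"
  using assms summable_real_powr_iff[of "- s"] by (subst summable_Suc_iff) simp

lemma mellin_bose: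
  assumes s: "s > 1"
  shows "has_bochner_integral lborel (\<lambda>x. indicator {0<..} x *\<^sub>R (bose x * x powr (s - 1)))
    (Gamma s * (\<Sum>n. real (Suc n) powr (- s)))"
proof -
  have "has_bochner_integral lborel (\<lambda>x. indicator {0<..} x *\<^sub>R (bose x * x powr (s - 1)))
    (\<Sum>n. Gamma s * real (Suc n) powr (- s))"
  proof (rule has_bochner_integral_nonneg_series[where f = "\<lambda>n x. x powr (s - 1) * exp (- real (Suc n) * x)"])
    show "(\<integral>\<^sup>+x. ennreal (x powr (s - 1) * exp (- real (Suc n) * x)) * indicator {0<..} x \<partial>lborel)
        = ennreal (Gamma s * real (Suc n) powr (- s))" for n
      by (rule nn_integral_powr_exp) (use s in auto)
    show "(\<lambda>n. x powr (s - 1) * exp (- real (Suc n) * x)) sums (bose x * x powr (s - 1))" if "x \<in> {0<..}" for x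
      using sums_mult[OF exp_sums_bose[of x], of "x powr (s - 1)"] that by (simp add: mult.commute)
    show "summable (\<lambda>n. Gamma s * real (Suc n) powr (- s))"
      by (intro summable_mult summable_Suc_powr s)
  qed (use s Gamma_real_pos[of s] in \<open>auto intro!: mult_nonneg_nonneg\<close>)
  then show ?thesis by (subst (asm) suminf_mult[OF summable_Suc_powr[OF s]])
qed

text \<open>Write \<open>1 / (1 + t)\<close> as the integral of \<open>exp (- (1 + t) * u)\<close> over \<open>u > 0\<close> and exchange the
  integrals.\<close>

lemma nn_integral_powr_over_one_plus:
  fixes z :: real
  assumes z: "0 < z" "z < 1"
  shows "(\<integral>\<^sup>+t. ennreal (t powr (z - 1) / (1 + t)) * indicator {0<..} t \<partial>lborel) = ennreal (Gamma z * Gamma (1 - z))"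
proof -
  let ?h = "\<lambda>t u::real. ennreal (t powr (z - 1) * exp (- u * t)) * indicator {0<..} t * (ennreal (exp (- u)) * indicator {0<..} u)"
  have "(\<integral>\<^sup>+t. ennreal (t powr (z - 1) / (1 + t)) * indicator {0<..} t \<partial>lborel) =
    (\<integral>\<^sup>+t. (\<integral>\<^sup>+u. ?h t u \<partial>lborel) \<partial>lborel)"
  proof (rule nn_integral_cong)
    fix t :: real
    show "ennreal (t powr (z - 1) / (1 + t)) * indicator {0<..} t = (\<integral>\<^sup>+u. ?h t u \<partial>lborel)"
    proof (cases "t > 0")
      case True
      \<comment> \<open>The factor \<open>u powr (1 - 1)\<close> equals 1 for u > 0 and presents the
        exponential integral as the case s = 1 of \<open>nn_integral_powr_exp\<close>.\<close>
      have "(\<integral>\<^sup>+u. ?h t u \<partial>lborel) = (\<integral>\<^sup>+u. ennreal (t powr (z - 1)) * (ennreal (u powr (1 - 1) * exp (- (1 + t) * u)) * indicator {0<..} u) \<partial>lborel)"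
        using True by (intro nn_integral_cong) (auto simp: indicator_def algebra_simps simp flip: ennreal_mult' exp_add)
      also have "\<dots> = ennreal (t powr (z - 1)) * (\<integral>\<^sup>+u. ennreal (u powr (1 - 1) * exp (- (1 + t) * u)) * indicator {0<..} u \<partial>lborel)"
        by (rule nn_integral_cmult) simp
      also have "\<dots> = ennreal (t powr (z - 1)) * ennreal (Gamma 1 * (1 + t) powr (- 1))"
        using True by (subst nn_integral_powr_exp) auto
      also have "\<dots> = ennreal (t powr (z - 1) / (1 + t)) * indicator {0<..} t"
        using True by (simp add: powr_minus divide_inverse ennreal_mult')
      finally show ?thesis ..
    qed simp
  qed
  also have "\<dots> = (\<integral>\<^sup>+u. (\<integral>\<^sup>+t. ?h t u \<partial>lborel) \<partial>lborel)"
    by (rule lborel_pair.Fubini'[symmetric]) (simp add: case_prod_unfold cong: measurable_cong_sets)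
  also have "\<dots> = (\<integral>\<^sup>+u. ennreal (Gamma z) * (ennreal (u powr ((1 - z) - 1) * exp (- 1 * u)) * indicator {0<..} u) \<partial>lborel)"
  proof (rule nn_integral_cong)
    fix u :: real
    show "(\<integral>\<^sup>+t. ?h t u \<partial>lborel) = ennreal (Gamma z) * (ennreal (u powr ((1 - z) - 1) * exp (- 1 * u)) * indicator {0<..} u)"
    proof (cases "u > 0")
      case True
      have "(\<integral>\<^sup>+t. ?h t u \<partial>lborel) = (\<integral>\<^sup>+t. ennreal (t powr (z - 1) * exp (- u * t)) * indicator {0<..} t \<partial>lborel) * (ennreal (exp (- u)) * indicator {0<..} u)"
        by (rule nn_integral_multc) simp
      also have "\<dots> = ennreal (Gamma z * u powr (- z)) * ennreal (exp (- u))"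
        using True z by (subst nn_integral_powr_exp) auto
      finally show ?thesis using True z by (simp add: ennreal_mult' mult.assoc)
    qed simp
  qed
  also have "\<dots> = ennreal (Gamma z) * (\<integral>\<^sup>+u. ennreal (u powr ((1 - z) - 1) * exp (- 1 * u)) * indicator {0<..} u \<partial>lborel)"
    by (rule nn_integral_cmult) simp
  also have "\<dots> = ennreal (Gamma z) * ennreal (Gamma (1 - z) * 1 powr (- (1 - z)))"
    using z by (subst nn_integral_powr_exp) auto
  finally show ?thesis using z by (simp add: ennreal_mult')
qed

text \<open>The substitution rule concerns absolutely integrable functions; nonnegativity lets the
  extended integral pass to that setting and back.\<close>

lemma nn_integral_change_of_variables_nonneg:
  fixes f g g' :: "real \<Rightarrow> real"
  assumes S: "S \<in> sets borel" and T: "T \<in> sets borel" "g ` S = T"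
    and der: "\<And>x. x \<in> S \<Longrightarrow> (g has_field_derivative g' x) (at x within S)"
    and inj: "inj_on g S"
    and meas: "f \<in> borel_measurable borel" and nonneg: "\<And>x. x \<in> T \<Longrightarrow> 0 \<le> f x"
    and int: "(\<integral>\<^sup>+x. ennreal (f x) * indicator T x \<partial>lborel) = ennreal c" and c: "0 \<le> c"
  shows "(\<integral>\<^sup>+x. ennreal (\<bar>g' x\<bar> * f (g x)) * indicator S x \<partial>lborel) = ennreal c"
proof -
  have "has_bochner_integral lborel (\<lambda>x. indicator T x *\<^sub>R f x) c"
  proof (rule has_bochner_integral_nn_integral)
    have "(\<integral>\<^sup>+x. ennreal (indicator T x *\<^sub>R f x) \<partial>lborel) = (\<integral>\<^sup>+x. ennreal (f x) * indicator T x \<partial>lborel)"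
      by (intro nn_integral_cong) (simp add: indicator_def)
    then show "(\<integral>\<^sup>+x. ennreal (indicator T x *\<^sub>R f x) \<partial>lborel) = ennreal c" using int by simp
  qed (use c meas T nonneg in \<open>auto simp: indicator_def\<close>)
  then have lb: "set_integrable lborel T f" "(LINT x:T|lborel. f x) = c"
    by (auto simp: set_integrable_def set_lebesgue_integral_def has_bochner_integral_iff)
  have "f absolutely_integrable_on T" "integral T f = c"
    using lb set_borel_integral_eq_integral[OF lb(1)] integrable_completion[of "\<lambda>x. indicator T x *\<^sub>R f x" lborel]
    by (auto simp: set_integrable_def)
  then have "(\<lambda>x. \<bar>g' x\<bar> * f (g x)) absolutely_integrable_on S \<and> integral S (\<lambda>x. \<bar>g' x\<bar> * f (g x)) = c"
    using has_absolute_integral_change_of_variables_1'[OF _ der inj, of f c] S T by auto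
  then have "((\<lambda>x. \<bar>g' x\<bar> * f (g x)) has_integral c) S"
    using set_lebesgue_integral_eq_integral(1) integrable_integral by blast
  then show ?thesis
    by (rule nn_integral_has_integral_lebesgue'[rotated]) (use nonneg T in auto)
qed

text \<open>Reflection at (s+1)/2, where the sine is shifted by a quarter period. For odd integers s
  both sides are 0 by the conventions for poles and division.\<close>

lemma Gamma_reflection_half_real:
  fixes s :: real
  shows "Gamma ((s + 1) / 2) * Gamma (1 - (s + 1) / 2) = pi / cos (pi * s / 2)"
proof -
  let ?z = "(s + 1) / 2"
  have "complex_of_real (Gamma ?z * Gamma (1 - ?z)) = of_real pi / sin (of_real pi * of_real ?z)"
    unfolding Gamma_reflection_complex[symmetric] by (simp flip: Gamma_complex_of_real)
  also have "\<dots> = complex_of_real (pi / sin (pi * ?z))"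
    by (metis of_real_divide of_real_mult sin_of_real)
  finally have "Gamma ?z * Gamma (1 - ?z) = pi / sin (pi * ?z)"
    by (simp only: of_real_eq_iff)
  also have "pi * ?z = pi * s / 2 + pi / 2" by (simp add: field_simps)
  also have "sin (pi * s / 2 + pi / 2) = cos (pi * s / 2)" by (simp add: sin_add)
  finally show ?thesis .
qed

lemma cos_half_pi_pos:
  fixes s :: real
  assumes "-1 < s" "s < 1"
  shows "cos (pi * s / 2) > 0"
proof (rule cos_gt_zero_pi)
  have "pi * s < pi * 1" "pi * (-1) < pi * s" using assms by (intro mult_strict_left_mono; simp)+
  then show "pi * s / 2 < pi / 2" "- (pi / 2) < pi * s / 2" by simp_all
qed

text \<open>The substitution t = (x/a)^2 leads to t^(z-1)/(1+t) with z = (s+1)/2, and -1 < s < 1 is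
  exactly 0 < z < 1.\<close>

lemma nn_integral_powr_over_sum_squares:
  fixes a s :: real
  assumes a: "a > 0" and s: "-1 < s" "s < 1"
  shows "(\<integral>\<^sup>+x. ennreal (2 * x / (x\<^sup>2 + a\<^sup>2) * x powr (s - 1)) * indicator {0<..} x \<partial>lborel)
     = ennreal (a powr (s - 1) * (pi / cos (pi * s / 2)))"
proof -
  let ?z = "(s + 1) / 2"
  let ?f = "\<lambda>t::real. t powr (?z - 1) / (1 + t)" and ?g = "\<lambda>x::real. x\<^sup>2 / a\<^sup>2" and ?g' = "\<lambda>x::real. 2 * x / a\<^sup>2"
  have z: "0 < ?z" "?z < 1" using s by auto
  have img: "?g ` {0<..} = {0<..}"
  proof (intro equalityI subsetI)
    fix y :: real assume "y \<in> {0<..}"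
    then have "y = ?g (a * sqrt y)" "a * sqrt y \<in> {0<..}" using a by (auto simp: power_mult_distrib)
    then show "y \<in> ?g ` {0<..}" by blast
  qed (use a in auto)
  have inj: "inj_on ?g {0<..}"
    using a by (auto simp: inj_on_def)
  have cov: "(\<integral>\<^sup>+x. ennreal (\<bar>?g' x\<bar> * ?f (?g x)) * indicator {0<..} x \<partial>lborel) = ennreal (Gamma ?z * Gamma (1 - ?z))"
  proof (rule nn_integral_change_of_variables_nonneg[OF _ _ img _ inj])
    show "(?g has_field_derivative ?g' x) (at x within {0<..})" for x
      using a by (auto intro!: derivative_eq_intros simp: power2_eq_square)
    show "(\<integral>\<^sup>+x. ennreal (?f x) * indicator {0<..} x \<partial>lborel) = ennreal (Gamma ?z * Gamma (1 - ?z))"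
      by (rule nn_integral_powr_over_one_plus[OF z])
    show "0 \<le> Gamma ?z * Gamma (1 - ?z)"
      using z by (intro mult_nonneg_nonneg less_imp_le[OF Gamma_real_pos]) auto
  qed auto
  have "ennreal (2 * x / (x\<^sup>2 + a\<^sup>2) * x powr (s - 1)) * indicator {0<..} x
    = ennreal (a powr (s - 1)) * (ennreal (\<bar>?g' x\<bar> * ?f (?g x)) * indicator {0<..} x)" for x
  proof (cases "x > 0")
    case True
    have "(?g x) powr (?z - 1) = (x / a) powr (s - 1)"
    proof -
      have "?g x = (x / a) powr 2" using True a by (simp add: power_divide)
      then have "(?g x) powr (?z - 1) = (x / a) powr (2 * (?z - 1))" by (simp only: powr_powr)
      also have "2 * (?z - 1) = s - 1" by simp
      finally show ?thesis .
    qed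
    then have p: "a powr (s - 1) * (?g x) powr (?z - 1) = x powr (s - 1)"
      using True a by (simp add: powr_divide)
    have q: "?g' x / (1 + ?g x) = 2 * x / (x\<^sup>2 + a\<^sup>2)"
    proof -
      have "1 + ?g x = (x\<^sup>2 + a\<^sup>2) / a\<^sup>2" using a by (simp add: field_simps)
      then show ?thesis using a by simp
    qed
    have "a powr (s - 1) * (\<bar>?g' x\<bar> * ?f (?g x)) = (?g' x / (1 + ?g x)) * (a powr (s - 1) * (?g x) powr (?z - 1))"
      using True by simp
    also have "\<dots> = 2 * x / (x\<^sup>2 + a\<^sup>2) * x powr (s - 1)" unfolding p q ..
    finally show ?thesis using True by (simp flip: ennreal_mult')
  qed simp
  then have "(\<integral>\<^sup>+x. ennreal (2 * x / (x\<^sup>2 + a\<^sup>2) * x powr (s - 1)) * indicator {0<..} x \<partial>lborel)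
     = (\<integral>\<^sup>+x. ennreal (a powr (s - 1)) * (ennreal (\<bar>?g' x\<bar> * ?f (?g x)) * indicator {0<..} x) \<partial>lborel)"
    by (simp only:)
  also have "\<dots> = ennreal (a powr (s - 1)) * (\<integral>\<^sup>+x. ennreal (\<bar>?g' x\<bar> * ?f (?g x)) * indicator {0<..} x \<partial>lborel)"
    by (rule nn_integral_cmult) simp
  also have "\<dots> = ennreal (a powr (s - 1) * (pi / cos (pi * s / 2)))"
    unfolding cov Gamma_reflection_half_real by (rule ennreal_mult'[symmetric]) simp
  finally show ?thesis .
qed

text \<open>Integrating the partial fractions term by term leaves the powers (2 pi n)^(s-1); s < 0
  makes their sum converge, to zeta(1-s) up to a factor.\<close>

lemma mellin_bose_rem:
  fixes s :: real
  assumes s: "-1 < s" "s < 0"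
  shows "has_bochner_integral lborel (\<lambda>x. indicator {0<..} x *\<^sub>R (bose_rem x * x powr (s - 1)))
    ((2 * pi) powr (s - 1) * (pi / cos (pi * s / 2)) * (\<Sum>n. real (Suc n) powr (- (1 - s))))"
proof -
  have cos: "cos (pi * s / 2) > 0" using s by (intro cos_half_pi_pos) auto
  let ?c = "(2 * pi) powr (s - 1) * (pi / cos (pi * s / 2))"
  have sm: "summable (\<lambda>n. real (Suc n) powr (- (1 - s)))" using s by (intro summable_Suc_powr) simp
  have "has_bochner_integral lborel (\<lambda>x. indicator {0<..} x *\<^sub>R (bose_rem x * x powr (s - 1)))
    (\<Sum>n. ?c * real (Suc n) powr (- (1 - s)))"
  proof (rule has_bochner_integral_nonneg_series[where f = "\<lambda>n x. 2 * x / (x\<^sup>2 + (2 * pi * real (Suc n))\<^sup>2) * x powr (s - 1)"])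
    show "(\<integral>\<^sup>+x. ennreal (2 * x / (x\<^sup>2 + (2 * pi * real (Suc n))\<^sup>2) * x powr (s - 1)) * indicator {0<..} x \<partial>lborel)
        = ennreal (?c * real (Suc n) powr (- (1 - s)))" for n
    proof -
      have "(2 * pi * real (Suc n)) powr (s - 1) * (pi / cos (pi * s / 2)) = ?c * real (Suc n) powr (- (1 - s))"
        unfolding powr_mult[of "2 * pi" "real (Suc n)"] minus_diff_eq by (simp only: mult_ac)
      then show ?thesis
        using nn_integral_powr_over_sum_squares[of "2 * pi * real (Suc n)" s] s by (simp only:) simp
    qed
    show "(\<lambda>n. 2 * x / (x\<^sup>2 + (2 * pi * real (Suc n))\<^sup>2) * x powr (s - 1)) sums (bose_rem x * x powr (s - 1))"
      if "x \<in> {0<..}" for x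
      using that by (intro sums_mult2 bose_rem_sums) simp
    show "summable (\<lambda>n. ?c * real (Suc n) powr (- (1 - s)))"
      by (intro summable_mult sm)
  qed (use cos in auto)
  then show ?thesis by (subst (asm) suminf_mult[OF sm])
qed

section \<open>Splitting the Mellin integrals at 1\<close>

lemma has_bochner_integral_of_has_integral_nonneg:
  fixes f :: "real \<Rightarrow> real"
  assumes "S \<in> sets borel" "f \<in> borel_measurable borel" "\<And>x. x \<in> S \<Longrightarrow> 0 \<le> f x" "(f has_integral c) S"
  shows "has_bochner_integral lborel (\<lambda>x. indicator S x *\<^sub>R f x) c"
proof (rule has_bochner_integral_nn_integral)
  show "(\<integral>\<^sup>+x. ennreal (indicator S x *\<^sub>R f x) \<partial>lborel) = ennreal c"
    using nn_integral_has_integral_lebesgue[OF assms(3,4)] by simp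
  show "0 \<le> c" using has_integral_nonneg[OF assms(4,3)] by simp
qed (use assms in \<open>auto simp: indicator_def\<close>)

lemma set_integral_powr_unit:
  fixes e :: real
  assumes "e > -1"
  shows "set_integrable lborel {0<..1} (\<lambda>x. x powr e)" "(LINT x:{0<..1}|lborel. x powr e) = 1 / (e + 1)"
proof -
  \<comment> \<open>Since \<open>0 powr e\<close> is 0, including the endpoint 0 does not change the
    integrand.\<close>
  have eq: "(\<lambda>x. indicator {0..1} x *\<^sub>R (x powr e)) = (\<lambda>x::real. indicator {0<..1} x *\<^sub>R (x powr e))"
    by (rule ext) (auto simp: indicator_def)
  have "has_bochner_integral lborel (\<lambda>x. indicator {0..1} x *\<^sub>R (x powr e)) (1 powr (e + 1) / (e + 1))"
    by (rule has_bochner_integral_of_has_integral_nonneg[OF _ _ _ has_integral_powr_from_0]) (use assms in auto)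
  then show "set_integrable lborel {0<..1} (\<lambda>x. x powr e)" "(LINT x:{0<..1}|lborel. x powr e) = 1 / (e + 1)"
    unfolding eq by (simp_all add: set_integrable_def set_lebesgue_integral_def has_bochner_integral_iff)
qed

lemma set_integral_powr_tail:
  fixes e :: real
  assumes "e < -1"
  shows "set_integrable lborel {1<..} (\<lambda>x. x powr e)" "(LINT x:{1<..}|lborel. x powr e) = - 1 / (e + 1)"
proof -
  have "((\<lambda>x. x powr e) has_integral - (1 powr (e + 1)) / (e + 1)) {1<..}"
    by (rule iffD1[OF has_integral_spike_set_eq has_integral_powr_to_inf[of e 1]])
      (use assms in \<open>auto intro: negligible_subset[of "{1}"]\<close>)
  then have "has_bochner_integral lborel (\<lambda>x. indicator {1<..} x *\<^sub>R (x powr e)) (- (1 powr (e + 1)) / (e + 1))"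
    by (rule has_bochner_integral_of_has_integral_nonneg[rotated 3]) auto
  then show "set_integrable lborel {1<..} (\<lambda>x. x powr e)" "(LINT x:{1<..}|lborel. x powr e) = - 1 / (e + 1)"
    by (simp_all add: set_integrable_def set_lebesgue_integral_def has_bochner_integral_iff)
qed

lemma bose_rem_nonneg: "x > 0 \<Longrightarrow> bose_rem x \<ge> 0"
  using sums_le[OF _ sums_zero bose_rem_sums[of x]] by simp

lemma bose_pos: "x > 0 \<Longrightarrow> bose x > 0"
  by (simp add: bose_def)

lemma borel_measurable_bose [measurable]: "bose \<in> borel_measurable borel"
  unfolding bose_def by measurable

lemma borel_measurable_bose_rem [measurable]: "bose_rem \<in> borel_measurable borel"
  unfolding bose_rem_def by measurable

lemma set_integrable_bose_rem:
  assumes "s > -1"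
  shows "set_integrable lborel {0<..1} (\<lambda>x. bose_rem x * x powr (s - 1))"
proof -
  \<comment> \<open>An exponent in the strip (-1, 0) of \<open>mellin_bose_rem\<close> and at most
    s; on (0, 1] the smaller exponent gives the larger integrand.\<close>
  let ?t = "min s (- 1 / 2)"
  have "set_integrable lborel {0<..} (\<lambda>x. bose_rem x * x powr (?t - 1))"
    using mellin_bose_rem[of ?t] assms by (auto simp: set_integrable_def has_bochner_integral_iff)
  then have "set_integrable lborel {0<..1} (\<lambda>x. bose_rem x * x powr (?t - 1))"
    by (rule set_integrable_subset) auto
  then show ?thesis
  proof (rule set_integrable_bound)
    show "set_borel_measurable lborel {0<..1} (\<lambda>x. bose_rem x * x powr (s - 1))"
      unfolding set_borel_measurable_def by measurable
    show "AE x in lborel. x \<in> {0<..1} \<longrightarrow> norm (bose_rem x * x powr (s - 1)) \<le> norm (bose_rem x * x powr (?t - 1))"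
      using bose_rem_nonneg by (intro AE_I2 impI) (auto simp: abs_mult intro!: mult_left_mono powr_mono')
  qed
qed

lemma set_integrable_bose:
  "set_integrable lborel {1<..} (\<lambda>x. bose x * x powr (s - 1))"
proof -
  \<comment> \<open>An exponent in the range of \<open>mellin_bose\<close> and at least s; beyond 1
    the larger exponent gives the larger integrand.\<close>
  let ?t = "max s 2"
  have "set_integrable lborel {0<..} (\<lambda>x. bose x * x powr (?t - 1))"
    using mellin_bose[of ?t] by (auto simp: set_integrable_def has_bochner_integral_iff)
  then have "set_integrable lborel {1<..} (\<lambda>x. bose x * x powr (?t - 1))"
    by (rule set_integrable_subset) auto
  then show ?thesis
  proof (rule set_integrable_bound)
    show "set_borel_measurable lborel {1<..} (\<lambda>x. bose x * x powr (s - 1))"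
      unfolding set_borel_measurable_def by measurable
    show "AE x in lborel. x \<in> {1<..} \<longrightarrow> norm (bose x * x powr (s - 1)) \<le> norm (bose x * x powr (?t - 1))"
      by (intro AE_I2 impI) (auto simp: abs_mult intro!: mult_left_mono powr_mono)
  qed
qed

text \<open>Each piece of the half-line carries the function whose integral converges there: the
  remainder near 0, where s > -1 is enough, and \<open>bose\<close> near infinity, where every s
  works.\<close>

definition mellin_reg :: "real \<Rightarrow> real" where
  "mellin_reg s = (LINT x:{0<..1}|lborel. bose_rem x * x powr (s - 1)) +
     (LINT x:{1<..}|lborel. bose x * x powr (s - 1))"

lemma bose_rem_times_powr:
  assumes "x > 0"
  shows "bose_rem x * x powr (s - 1) = bose x * x powr (s - 1) - x powr (s - 2) + x powr (s - 1) / 2"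
proof -
  have "x powr (s - 1) = x powr (s - 2) * x powr 1"
    using powr_add[of x "s - 2" 1] by simp
  then have "x powr (s - 2) = x powr (s - 1) / x" using assms by simp
  then show ?thesis by (simp add: bose_rem_def algebra_simps)
qed

text \<open>For s > 1 the terms removed from \<open>bose\<close> on (0, 1] are integrable and supply
  the rational function.\<close>

lemma mellin_bose_eq_reg:
  assumes s: "s > 1"
  shows "Gamma s * (\<Sum>n. real (Suc n) powr (- s)) = mellin_reg s + 1 / (s - 1) - 1 / (2 * s)"
proof -
  let ?f = "\<lambda>x. bose x * x powr (s - 1)"
  have f: "set_integrable lborel {0<..} ?f" "(LINT x:{0<..}|lborel. ?f x) = Gamma s * (\<Sum>n. real (Suc n) powr (- s))"
    using mellin_bose[OF s] by (auto simp: set_integrable_def set_lebesgue_integral_def has_bochner_integral_iff)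
  have f1: "set_integrable lborel {0<..1} ?f" and f2: "set_integrable lborel {1<..} ?f"
    by (rule set_integrable_subset[OF f(1)]; auto)+
  have U: "({0<..} :: real set) = {0<..1} \<union> {1<..}" by auto
  have "(LINT x:{0<..}|lborel. ?f x) = (LINT x:{0<..1}|lborel. ?f x) + (LINT x:{1<..}|lborel. ?f x)"
    unfolding U by (rule set_integral_Un[OF _ f1 f2]) auto
  moreover have "(LINT x:{0<..1}|lborel. bose_rem x * x powr (s - 1)) =
      (LINT x:{0<..1}|lborel. (?f x - x powr (s - 2) + x powr (s - 1) / 2))"
    by (rule set_lebesgue_integral_cong) (auto simp: bose_rem_times_powr)
  moreover have "\<dots> = (LINT x:{0<..1}|lborel. ?f x) - 1 / (s - 1) + 1 / (2 * s)"
    using f1 set_integral_powr_unit[of "s - 2"] set_integral_powr_unit[of "s - 1"] s by simp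
  ultimately show ?thesis using f(2) by (simp add: mellin_reg_def)
qed

text \<open>For s < 0 the same terms are integrable on (1, oo) instead; opposite sign and opposite
  end of the interval give the same rational function as for s > 1.\<close>

lemma mellin_bose_rem_eq_reg:
  assumes s: "-1 < s" "s < 0"
  shows "(2 * pi) powr (s - 1) * (pi / cos (pi * s / 2)) * (\<Sum>n. real (Suc n) powr (- (1 - s)))
     = mellin_reg s + 1 / (s - 1) - 1 / (2 * s)"
proof -
  let ?f = "\<lambda>x. bose_rem x * x powr (s - 1)"
  have f: "set_integrable lborel {0<..} ?f" "(LINT x:{0<..}|lborel. ?f x) =
      (2 * pi) powr (s - 1) * (pi / cos (pi * s / 2)) * (\<Sum>n. real (Suc n) powr (- (1 - s)))"
    using mellin_bose_rem[OF s] by (auto simp: set_integrable_def set_lebesgue_integral_def has_bochner_integral_iff)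
  have f1: "set_integrable lborel {0<..1} ?f" and f2: "set_integrable lborel {1<..} ?f"
    by (rule set_integrable_subset[OF f(1)]; auto)+
  have U: "({0<..} :: real set) = {0<..1} \<union> {1<..}" by auto
  have "(LINT x:{0<..}|lborel. ?f x) = (LINT x:{0<..1}|lborel. ?f x) + (LINT x:{1<..}|lborel. ?f x)"
    unfolding U by (rule set_integral_Un[OF _ f1 f2]) auto
  moreover have "(LINT x:{1<..}|lborel. ?f x) =
      (LINT x:{1<..}|lborel. (bose x * x powr (s - 1) - x powr (s - 2) + x powr (s - 1) / 2))"
    by (rule set_lebesgue_integral_cong) (auto simp: bose_rem_times_powr)
  moreover have "\<dots> = (LINT x:{1<..}|lborel. bose x * x powr (s - 1)) + 1 / (s - 1) - 1 / (2 * s)"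
    using set_integrable_bose[of s] set_integral_powr_tail[of "s - 2"] set_integral_powr_tail[of "s - 1"] s by simp
  ultimately show ?thesis using f(2) by (simp add: mellin_reg_def)
qed

section \<open>The zeta function and its functional equation\<close>

definition zeta_series :: "complex \<Rightarrow> complex" where
  "zeta_series s = (\<Sum>n. 1 / of_nat (Suc n) powr s)"

lemma norm_nat_powr: "norm (of_nat (Suc n) powr s :: complex) = real (Suc n) powr Re s"
  using norm_powr_real_powr[of "of_nat (Suc n)" s] by simp

lemma zeta_series_sums:
  assumes "Re s > 1"
  shows "(\<lambda>n. 1 / of_nat (Suc n) powr s) sums zeta_series s"
proof -
  have "summable (\<lambda>n. norm (1 / of_nat (Suc n) powr s :: complex))"
    unfolding norm_divide norm_nat_powr
    using summable_Suc_powr[OF assms] by (simp only: norm_one powr_minus_divide)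
  then show ?thesis
    unfolding zeta_series_def by (rule summable_sums[OF summable_norm_cancel])
qed

lemma zeta_series_holomorphic: "zeta_series holomorphic_on {s. Re s > 1}"
proof -
  have "(\<lambda>s. \<Sum>n. 1 / of_nat (Suc n) powr s :: complex) holomorphic_on {s. Re s > 1}"
  proof (rule holomorphic_on_suminf_locally)
    fix z assume "z \<in> {s. Re s > 1}"
    then obtain a where a: "1 < a" "a < Re z" using dense by auto
    show "\<exists>V B. open V \<and> z \<in> V \<and> summable B \<and> (\<forall>n. (\<lambda>s. 1 / of_nat (Suc n) powr s :: complex) holomorphic_on V) \<and>
        (\<forall>s\<in>V. \<forall>n. norm (1 / of_nat (Suc n) powr s :: complex) \<le> B n)"
    proof (intro exI conjI ballI allI)
      show "open {s. Re s > a}" by (rule open_halfspace_Re_gt)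
      show "summable (\<lambda>n. real (Suc n) powr (- a))" by (rule summable_Suc_powr[OF a(1)])
      show "(\<lambda>s. 1 / of_nat (Suc n) powr s :: complex) holomorphic_on {s. Re s > a}" for n
        by (intro holomorphic_intros) auto
      fix s n assume "s \<in> {s. Re s > a}"
      then have "real (Suc n) powr (- Re s) \<le> real (Suc n) powr (- a)"
        by (intro powr_mono) auto
      then show "norm (1 / of_nat (Suc n) powr s :: complex) \<le> real (Suc n) powr (- a)"
        unfolding norm_divide norm_nat_powr by (simp only: norm_one powr_minus_divide)
    qed (use a in auto)
  qed
  then show ?thesis by (simp add: zeta_series_def[abs_def])
qed

lemma zeta_series_of_real:
  assumes "s > 1"
  shows "zeta_series (of_real s) = of_real (\<Sum>n. real (Suc n) powr (- s))"
proof -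
  have "(1 / of_nat (Suc n) powr of_real s :: complex) = of_real (real (Suc n) powr (- s))" for n
    using powr_of_real[of "real (Suc n)" s] by (simp add: powr_minus_divide)
  then show ?thesis
    unfolding zeta_series_def by (simp only: suminf_of_real[OF summable_Suc_powr[OF assms]])
qed

definition mellin_lo :: "complex \<Rightarrow> complex" where
  "mellin_lo s = (LINT x:{0<..1}|lborel. of_real (bose_rem x) * of_real x powr (s - 1))"

definition mellin_hi :: "complex \<Rightarrow> complex" where
  "mellin_hi s = (LINT x:{1<..}|lborel. of_real (bose x) * of_real x powr (s - 1))"

lemma mellin_lo_holomorphic: "mellin_lo holomorphic_on {s. Re s > -1}"
  unfolding mellin_lo_def
proof (rule holomorphic_on_mellin[where T = "{-1<..}"])
  fix s :: real assume "s \<in> {-1<..}"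
  then have "set_integrable lborel {0<..1} (\<lambda>x. bose_rem x * x powr (s - 1))"
    by (intro set_integrable_bose_rem) simp
  then show "set_integrable lborel {0<..1} (\<lambda>x. \<bar>bose_rem x\<bar> * x powr (s - 1))"
    by (rule iffD1[OF set_integrable_cong, rotated 3]) (use bose_rem_nonneg in auto)
next
  show "{s. - 1 < Re s} = {s. \<exists>a\<in>{- 1<..}. \<exists>b\<in>{- 1<..}. a < Re s \<and> Re s < b}"
  proof (intro Set.set_eqI iffI)
    fix s assume "s \<in> {s. - 1 < Re s}"
    then have "-1 < (Re s - 1) / 2" "(Re s - 1) / 2 < Re s" "-1 < Re s + 1" "Re s < Re s + 1" by auto
    then show "s \<in> {s. \<exists>a\<in>{- 1<..}. \<exists>b\<in>{- 1<..}. a < Re s \<and> Re s < b}" by blast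
  qed auto
qed (auto simp: set_borel_measurable_def)

lemma mellin_hi_holomorphic: "mellin_hi holomorphic_on S"
proof -
  have "mellin_hi holomorphic_on UNIV"
    unfolding mellin_hi_def
  proof (rule holomorphic_on_mellin[where T = UNIV])
    fix s :: real
    show "set_integrable lborel {1<..} (\<lambda>x. \<bar>bose x\<bar> * x powr (s - 1))"
      by (rule iffD1[OF set_integrable_cong set_integrable_bose[of s]])
        (use bose_pos in \<open>auto simp: less_imp_le\<close>)
  next
    show "UNIV = {s. \<exists>a\<in>UNIV. \<exists>b\<in>UNIV. a < Re s \<and> Re s < b}"
      using lt_ex gt_ex by auto
  qed (auto simp: set_borel_measurable_def)
  then show ?thesis using holomorphic_on_subset by blast
qed

lemma mellin_of_real: "mellin_lo (of_real s) + mellin_hi (of_real s) = of_real (mellin_reg s)"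
proof -
  have pw: "complex_of_real x powr (of_real s - 1) = of_real (x powr (s - 1))" if "x > 0" for x
    using powr_of_real[of x "s - 1"] that by simp
  have "mellin_lo (of_real s) = of_real (LINT x:{0<..1}|lborel. bose_rem x * x powr (s - 1))"
    unfolding mellin_lo_def set_integral_complex_of_real[symmetric]
    by (rule set_lebesgue_integral_cong) (auto simp: pw)
  moreover have "mellin_hi (of_real s) = of_real (LINT x:{1<..}|lborel. bose x * x powr (s - 1))"
    unfolding mellin_hi_def set_integral_complex_of_real[symmetric]
    by (rule set_lebesgue_integral_cong) (auto simp: pw)
  ultimately show ?thesis by (simp add: mellin_reg_def)
qed

text \<open>This is \<open>rGamma s\<close> times the Mellin integral of \<open>bose\<close>, in which the removed terms contribute
  \<open>1 / (s - 1) - 1 / (2 * s)\<close>; the apparent pole at 0 is absorbed by \<open>rGamma s = s * rGamma (s + 1)\<close>.\<close>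

definition zeta_right :: "complex \<Rightarrow> complex" where
  "zeta_right s = rGamma s * (mellin_lo s + mellin_hi s + 1 / (s - 1)) - rGamma (s + 1) / 2"

text \<open>The right side of the functional equation with the Dirichlet series in place of zeta at
  1 - s, hence meant for Re s < 0.\<close>

definition zeta_left :: "complex \<Rightarrow> complex" where
  "zeta_left s = 2 * of_real (2 * pi) powr (s - 1) * sin (of_real pi * s / 2) * Gamma (1 - s) * zeta_series (1 - s)"

lemma zeta_right_holomorphic: "zeta_right holomorphic_on {s. Re s > -1} - {1}"
  unfolding zeta_right_def
  by (intro holomorphic_intros holomorphic_on_subset[OF mellin_lo_holomorphic] mellin_hi_holomorphic) auto

lemma Gamma_one_minus_holomorphic: "(\<lambda>s. Gamma (1 - s)) holomorphic_on {s :: complex. Re s < 1}"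
proof (intro holomorphic_intros)
  fix s :: complex assume "s \<in> {s. Re s < 1}"
  then show "1 - s \<notin> \<int>\<^sub>\<le>\<^sub>0" by (auto elim!: nonpos_Ints_cases simp: complex_eq_iff)
qed

lemma zeta_left_holomorphic: "zeta_left holomorphic_on {s. Re s < 0}"
proof -
  have "(\<lambda>s. zeta_series (1 - s)) holomorphic_on {s. Re s < 0}"
    by (rule holomorphic_on_compose_gen[OF _ zeta_series_holomorphic, unfolded o_def])
      (auto intro!: holomorphic_intros)
  then show ?thesis
    unfolding zeta_left_def
    by (intro holomorphic_intros holomorphic_on_subset[OF Gamma_one_minus_holomorphic]) auto
qed

lemma zeta_right_of_real:
  assumes "s \<noteq> 0"
  shows "zeta_right (of_real s) = rGamma (of_real s) * of_real (mellin_reg s + 1 / (s - 1) - 1 / (2 * s))"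
proof -
  have r: "rGamma (complex_of_real s) = of_real s * rGamma (of_real s + 1)"
    by (simp add: rGamma_plus1)
  have "complex_of_real (mellin_reg s + 1 / (s - 1) - 1 / (2 * s)) =
     of_real (mellin_reg s) + 1 / (of_real s - 1) - 1 / (2 * of_real s)" by simp
  then show ?thesis
    unfolding zeta_right_def mellin_of_real r using assms by (simp add: algebra_simps)
qed

text \<open>On the real interval (1, 2) the factor rGamma cancels the Gamma of the Mellin transform;
  the identity theorem does the rest.\<close>

lemma zeta_right_eq_series:
  assumes "Re s > 1"
  shows "zeta_right s = zeta_series s"
proof (rule holomorphic_eq_if_eq_on_reals[where f = zeta_right and g = zeta_series and w = s and a = 1 and b = 2])
  show "zeta_right holomorphic_on {s. Re s > 1}"
    by (rule holomorphic_on_subset[OF zeta_right_holomorphic]) auto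
  show "connected {s. Re s > 1}" by (rule convex_connected[OF convex_halfspace_Re_gt])
  show "zeta_right (of_real x) = zeta_series (of_real x)" if "1 < x" "x < 2" for x
  proof -
    have "rGamma (complex_of_real x) * Gamma (of_real x) = 1"
      using that by (simp add: rGamma_inverse_Gamma Gamma_complex_of_real Gamma_real_pos less_imp_neq[symmetric])
    then have "rGamma (complex_of_real x) * of_real (Gamma x) = 1" by (simp add: Gamma_complex_of_real)
    then show ?thesis
      using that mellin_bose_eq_reg[of x, symmetric]
      by (simp only: zeta_right_of_real zeta_series_of_real of_real_mult mult.assoc[symmetric] mult_1)
  qed
qed (use assms open_halfspace_Re_gt zeta_series_holomorphic in auto)

lemma zeta_right_eq_left:
  assumes "-1 < Re s" "Re s < 0"
  shows "zeta_right s = zeta_left s"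
proof (rule holomorphic_eq_if_eq_on_reals[where f = zeta_right and g = zeta_left and w = s and a = "-1" and b = 0 and S = "{s. -1 < Re s} \<inter> {s. Re s < 0}"])
  show "zeta_right holomorphic_on {s. -1 < Re s} \<inter> {s. Re s < 0}"
    by (rule holomorphic_on_subset[OF zeta_right_holomorphic]) auto
  show "zeta_left holomorphic_on {s. -1 < Re s} \<inter> {s. Re s < 0}"
    by (rule holomorphic_on_subset[OF zeta_left_holomorphic]) auto
  show "open ({s. -1 < Re s} \<inter> {s. Re s < 0})"
    by (intro open_Int open_halfspace_Re_gt open_halfspace_Re_lt)
  show "connected ({s. -1 < Re s} \<inter> {s. Re s < 0})"
    by (intro convex_connected convex_Int convex_halfspace_Re_gt convex_halfspace_Re_lt)
  show "zeta_right (of_real x) = zeta_left (of_real x)" if x: "-1 < x" "x < 0" for x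
  proof -
    let ?Z = "\<Sum>n. real (Suc n) powr (- (1 - x))"
    have cos: "cos (pi * x / 2) \<noteq> 0" using cos_half_pi_pos[of x] x by simp
    have "rGamma (complex_of_real x) * rGamma (1 - of_real x) = sin (of_real pi * of_real x) / of_real pi"
      by (rule rGamma_reflection_complex)
    then have "complex_of_real (rGamma x * rGamma (1 - x)) = of_real (sin (pi * x) / pi)"
      by (metis of_real_1 of_real_diff of_real_divide of_real_mult rGamma_complex_of_real sin_of_real)
    then have "rGamma x * rGamma (1 - x) = sin (pi * x) / pi"
      by (simp only: of_real_eq_iff)
    moreover have "Gamma (1 - x) > 0" using x by (intro Gamma_real_pos) simp
    ultimately have r: "rGamma x = Gamma (1 - x) * (sin (pi * x) / pi)"
      by (simp add: rGamma_inverse_Gamma[of "1 - x"] field_simps)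
    \<comment> \<open>The double angle releases a cosine that cancels the one in the denominator of
      the Mellin transform and leaves the sine of the functional equation.\<close>
    have s2: "sin (pi * x) = 2 * sin (pi * x / 2) * cos (pi * x / 2)"
      using sin_double[of "pi * x / 2"] by simp
    have "zeta_right (of_real x) = of_real (rGamma x * ((2 * pi) powr (x - 1) * (pi / cos (pi * x / 2)) * ?Z))"
      unfolding mellin_bose_rem_eq_reg[OF x] using zeta_right_of_real[of x] x
      by (simp only: of_real_mult rGamma_complex_of_real)
    also have "rGamma x * ((2 * pi) powr (x - 1) * (pi / cos (pi * x / 2)) * ?Z)
      = 2 * (2 * pi) powr (x - 1) * sin (pi * x / 2) * Gamma (1 - x) * ?Z"
      unfolding r s2 using cos by simp
    also have "complex_of_real \<dots> = zeta_left (of_real x)"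
    proof -
      have "complex_of_real (2 * pi) powr (of_real x - 1) = of_real ((2 * pi) powr (x - 1))"
        using powr_of_real[of "2 * pi" "x - 1"] by simp
      moreover have "sin (complex_of_real pi * of_real x / 2) = of_real (sin (pi * x / 2))"
        by (metis of_real_divide of_real_mult of_real_numeral sin_of_real)
      moreover have "Gamma (1 - complex_of_real x) = of_real (Gamma (1 - x))"
        by (metis Gamma_complex_of_real of_real_1 of_real_diff)
      moreover have "zeta_series (1 - complex_of_real x) = of_real ?Z"
        using zeta_series_of_real[of "1 - x"] x by simp
      ultimately show ?thesis unfolding zeta_left_def by simp
    qed
    finally show ?thesis .
  qed
qed (use assms in auto)

section \<open>The continuation to the punctured plane and the functional equation\<close>

definition zeta_glued :: "complex \<Rightarrow> complex" where
  "zeta_glued s = (if s = 1 then 0 else if Re s > -1 then zeta_right s else zeta_left s)"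

text \<open>Both formulas are holomorphic on open sets overlapping in the strip -1 < Re s < 0, where
  they agree; together these sets miss only 1.\<close>

lemma zeta_glued_holomorphic: "zeta_glued holomorphic_on - {1}"
proof -
  have "zeta_glued holomorphic_on ({s. Re s > -1} - {1}) \<union> {s. Re s < 0}"
  proof (rule holomorphic_on_Un)
    show "zeta_glued holomorphic_on {s. Re s > -1} - {1}"
      by (rule holomorphic_transform[OF zeta_right_holomorphic]) (auto simp: zeta_glued_def)
    show "zeta_glued holomorphic_on {s. Re s < 0}"
      by (rule holomorphic_transform[OF zeta_left_holomorphic]) (auto simp: zeta_glued_def zeta_right_eq_left)
  qed (auto intro: open_halfspace_Re_gt open_halfspace_Re_lt open_delete)
  moreover have "({s. Re s > -1} - {1}) \<union> {s. Re s < 0} = - {1}" by auto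
  ultimately show ?thesis by simp
qed

lemma zeta_glued_eq_series:
  assumes "Re s > 1"
  shows "zeta_glued s = zeta_series s"
  using zeta_right_eq_series[OF assms] assms by (auto simp: zeta_glued_def)

text \<open>The definite description needs uniqueness: the punctured plane is connected, so the
  values for Re s > 1 determine the function, and the value at 1 is prescribed.\<close>

lemma riemann_zeta_eq_glued: "riemann_zeta = zeta_glued"
  unfolding riemann_zeta_def
proof (rule the_equality)
  show "zeta_glued holomorphic_on - {1} \<and>
      (\<forall>s. 1 < Re s \<longrightarrow> (\<lambda>n. 1 / of_nat (Suc n) powr s) sums zeta_glued s) \<and> zeta_glued 1 = 0"
    using zeta_glued_holomorphic zeta_series_sums zeta_glued_eq_series by (simp add: zeta_glued_def[of 1])
  fix f :: "complex \<Rightarrow> complex"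
  assume f: "f holomorphic_on - {1} \<and> (\<forall>s. 1 < Re s \<longrightarrow> (\<lambda>n. 1 / of_nat (Suc n) powr s) sums f s) \<and> f 1 = 0"
  show "f = zeta_glued"
  proof
    fix s
    show "f s = zeta_glued s"
    proof (cases "s = 1")
      case False
      show ?thesis
      proof (rule analytic_continuation_open[where s = "{s. Re s > 1}" and s' = "- {1}" and f = f and g = zeta_glued and z = s])
        show "connected (- {1 :: complex})" by (rule connected_punctured_universe) simp
        have "2 \<in> {s. Re s > 1}" by simp
        then show "{s. Re s > 1} \<noteq> {}" by blast
        show "f z = zeta_glued z" if z: "z \<in> {s. Re s > 1}" for z
        proof -
          have "(\<lambda>n. 1 / of_nat (Suc n) powr z) sums f z" using f z by blast
          moreover have "(\<lambda>n. 1 / of_nat (Suc n) powr z) sums zeta_series z"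
            using z by (intro zeta_series_sums) simp
          ultimately show ?thesis using z zeta_glued_eq_series[of z] sums_unique2 by force
        qed
      qed (use f zeta_glued_holomorphic False in \<open>auto intro: open_halfspace_Re_gt\<close>)
    qed (use f in \<open>simp add: zeta_glued_def\<close>)
  qed
qed

lemma riemann_zeta_holomorphic: "riemann_zeta holomorphic_on - {1}"
  using zeta_glued_holomorphic riemann_zeta_eq_glued by simp

lemma riemann_zeta_eq_series: "Re s > 1 \<Longrightarrow> riemann_zeta s = zeta_series s"
  using zeta_glued_eq_series riemann_zeta_eq_glued by simp

text \<open>rGamma vanishes at 0, so only the separated term -rGamma(1)/2 survives.\<close>

lemma riemann_zeta_zero: "riemann_zeta 0 = - 1 / 2"
  by (simp add: riemann_zeta_eq_glued zeta_glued_def zeta_right_def)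

text \<open>For Re s < -1 this is the definition of the left part. It continues as long as
  Gamma(1-s) has no pole, except at s = 0, where 1 - s hits the pole of zeta.\<close>

lemma riemann_zeta_functional_equation:
  assumes "Re s < 1" "s \<noteq> 0"
  shows "riemann_zeta s =
    2 * of_real (2 * pi) powr (s - 1) * sin (of_real pi * s / 2) * Gamma (1 - s) * riemann_zeta (1 - s)"
    (is "_ = ?R s")
proof (rule analytic_continuation_open[where s = "{s. Re s < -1}" and s' = "{s. Re s < 1} - {0}" and f = riemann_zeta and g = ?R and z = s])
  show "connected ({s. Re s < 1} - {0 :: complex})"
    by (intro connected_open_delete open_halfspace_Re_lt convex_connected convex_halfspace_Re_lt) simp
  show "open ({s. Re s < 1} - {0 :: complex})" by (intro open_delete open_halfspace_Re_lt)
  have "-2 \<in> {s. Re s < -1}" by simp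
  then show "{s. Re s < -1} \<noteq> {}" by blast
  show "riemann_zeta holomorphic_on {s. Re s < 1} - {0}"
    by (rule holomorphic_on_subset[OF riemann_zeta_holomorphic]) auto
  have "(\<lambda>s. riemann_zeta (1 - s)) holomorphic_on {s. Re s < 1} - {0}"
    by (rule holomorphic_on_compose_gen[OF _ riemann_zeta_holomorphic, unfolded o_def])
      (auto intro!: holomorphic_intros)
  then show "?R holomorphic_on {s. Re s < 1} - {0}"
    by (intro holomorphic_intros holomorphic_on_subset[OF Gamma_one_minus_holomorphic]) auto
  show "riemann_zeta z = ?R z" if "z \<in> {s. Re s < -1}" for z
    using that riemann_zeta_eq_series[of "1 - z"]
    by (auto simp: riemann_zeta_eq_glued zeta_glued_def zeta_left_def)
qed (use assms in \<open>auto intro: open_halfspace_Re_lt\<close>)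

section \<open>The Dirichlet series of the Moebius function\<close>

lemma moebius_prime_mult:
  assumes p: "prime p" and d: "squarefree d" "\<not> p dvd d"
  shows "squarefree (p * d)" "moebius (p * d) = - moebius d"
proof -
  have cop: "coprime p d" using p d(2) prime_imp_coprime by blast
  show sf: "squarefree (p * d)"
    by (rule squarefree_mult_coprime[OF cop squarefree_prime[OF p] d(1)])
  have "d \<noteq> 0" using d(2) by (intro notI) simp
  then have "prime_factors (p * d) = insert p (prime_factors d)"
    using p by (simp add: prime_factors_product prime_factorization_prime prime_gt_0_nat)
  moreover have "p \<notin> prime_factors d" using d by auto
  ultimately show "moebius (p * d) = - moebius d"
    using sf d by (simp add: moebius_def)
qed

text \<open>For a prime p dividing n, the squarefree divisors pair off as d and p d with p not
  dividing d, and the two values cancel.\<close>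

lemma sum_moebius_divisors:
  assumes "n \<ge> 1"
  shows "(\<Sum>d | d dvd n. moebius d) = (if n = 1 then 1 else 0)"
proof (cases "n = 1")
  case True
  then show ?thesis by (simp add: moebius_def)
next
  case False
  then obtain p where p: "prime p" "p dvd n" using prime_factor_nat by blast
  have fin: "finite {d. d dvd n}" using assms by simp
  let ?S = "{d. d dvd n \<and> squarefree d \<and> \<not> p dvd d}"
  have finS: "finite ?S" by (rule finite_subset[OF _ fin]) auto
  have split: "{d. d dvd n \<and> squarefree d} = ?S \<union> (*) p ` ?S"
  proof (intro equalityI subsetI)
    fix d assume d: "d \<in> {d. d dvd n \<and> squarefree d}"
    show "d \<in> ?S \<union> (*) p ` ?S"
    proof (cases "p dvd d")
      case True
      then obtain e where e: "d = p * e" by blast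
      have "\<not> p dvd e"
      proof
        assume "p dvd e"
        then have "p\<^sup>2 dvd d" unfolding e power2_eq_square by (rule mult_dvd_mono[OF dvd_refl])
        then have "p dvd 1" using d squarefreeD by blast
        then show False using p by (simp add: prime_nat_iff)
      qed
      moreover have "e dvd n" "squarefree e"
        using d e dvd_trans[of e d n] squarefree_mono[of e d] by auto
      ultimately show ?thesis using e by blast
    qed (use d in auto)
  next
    fix d assume "d \<in> ?S \<union> (*) p ` ?S"
    then consider "d \<in> ?S" | e where "e \<in> ?S" "d = p * e" by blast
    then show "d \<in> {d. d dvd n \<and> squarefree d}"
    proof cases
      case 2
      then have "coprime p e" using p prime_imp_coprime by blast
      then have "d dvd n" using 2 p divides_mult by blast
      with 2 moebius_prime_mult(1)[OF p(1)] show ?thesis by simp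
    qed auto
  qed
  have "(\<Sum>d | d dvd n. moebius d) = (\<Sum>d | d dvd n \<and> squarefree d. moebius d)"
    using fin by (intro sum.mono_neutral_right) (auto simp: moebius_def)
  also have "\<dots> = (\<Sum>d\<in>?S. moebius d) + (\<Sum>d\<in>(*) p ` ?S. moebius d)"
    unfolding split by (rule sum.union_disjoint) (use finS in auto)
  also have "(\<Sum>d\<in>(*) p ` ?S. moebius d) = (\<Sum>d\<in>?S. moebius (p * d))"
    using p by (subst sum.reindex) (auto simp: inj_on_def prime_gt_0_nat)
  also have "\<dots> = (\<Sum>d\<in>?S. - moebius d)"
    by (rule sum.cong) (use moebius_prime_mult(2)[OF p(1)] in auto)
  finally show ?thesis using False by (simp add: sum_negf)
qed

lemma abs_moebius_le: "\<bar>moebius n\<bar> \<le> 1"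
  by (simp add: moebius_def)

lemma mertens_of_nat: "mertens (real n) = (\<Sum>m<n. moebius (Suc m))"
proof -
  have "{m. 1 \<le> m \<and> real m \<le> real n} = Suc ` {..<n}"
    by (auto simp: image_iff) (metis Suc_le_D Suc_le_eq lessThan_iff)
  then show ?thesis unfolding mertens_def by (simp add: sum.reindex)
qed

lemma mertens_Suc: "mertens (real (Suc n)) = mertens (real n) + moebius (Suc n)"
  unfolding mertens_of_nat by simp

lemma abs_mertens_le: "\<bar>mertens (real n)\<bar> \<le> int n"
proof -
  have "\<bar>mertens (real n)\<bar> \<le> (\<Sum>m<n. \<bar>moebius (Suc m)\<bar>)" unfolding mertens_of_nat by (rule sum_abs)
  also have "\<dots> \<le> (\<Sum>m<n. 1)" by (intro sum_mono abs_moebius_le)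
  finally show ?thesis by simp
qed

text \<open>Passes from series indexed from 0 to unordered sums over the positive integers, which
  can be regrouped by divisors.\<close>

lemma has_sum_shift_Suc:
  fixes f :: "nat \<Rightarrow> complex"
  assumes "summable (\<lambda>n. norm (f (Suc n)))"
  shows "(\<lambda>n. norm (f n)) summable_on {1..}" "infsum f {1..} = (\<Sum>n. f (Suc n))"
proof -
  have img: "{1..} = range Suc" by (auto simp: image_iff) (metis Suc_le_D)
  have "((\<lambda>n. f (Suc n)) has_sum (\<Sum>n. f (Suc n))) UNIV"
    by (rule norm_summable_imp_has_sum[OF assms]) (use assms summable_norm_cancel summable_sums in metis)
  then have "(f has_sum (\<Sum>n. f (Suc n))) {1..}"
    unfolding img by (subst has_sum_reindex) (auto simp: o_def)
  then show "infsum f {1..} = (\<Sum>n. f (Suc n))" by (rule infsumI)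
  have "(\<lambda>n. norm (f (Suc n))) summable_on UNIV"
    by (rule norm_summable_imp_summable_on) (use assms in simp)
  then show "(\<lambda>n. norm (f n)) summable_on {1..}"
    unfolding img by (subst summable_on_reindex) (auto simp: o_def)
qed

text \<open>Pairs (x, y) are grouped by their product n, with d = y as the divisor; absolute
  summability of the double family permits the regrouping.\<close>

lemma dirichlet_product:
  fixes a b :: "nat \<Rightarrow> complex"
  assumes a: "(\<lambda>n. norm (a n)) summable_on {1..}" and b: "(\<lambda>n. norm (b n)) summable_on {1..}"
  shows "infsum a {1..} * infsum b {1..} = (\<Sum>\<^sub>\<infinity>n\<in>{1..}. \<Sum>d | d dvd n. a (n div d) * b d)"
proof -
  let ?U = "{1..} :: nat set" and ?f = "\<lambda>(x, y). a x * b y"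
  have "(\<lambda>z. norm (?f z)) summable_on ?U \<times> ?U"
  proof (subst Infinite_Sum.abs_summable_on_Sigma_iff, intro conjI ballI)
    fix x
    show "(\<lambda>y. norm (?f (x, y))) summable_on ?U"
      using summable_on_cmult_right[OF b, of "norm (a x)"] by (simp add: norm_mult)
  next
    have "(\<lambda>x. infsum (\<lambda>y. norm (?f (x, y))) ?U) = (\<lambda>x. norm (a x) * infsum (\<lambda>y. norm (b y)) ?U)"
      by (simp add: norm_mult infsum_cmult_right')
    moreover have "(\<lambda>x. norm (a x) * infsum (\<lambda>y. norm (b y)) ?U) summable_on ?U"
      by (rule summable_on_cmult_left[OF a])
    ultimately show "(\<lambda>x. norm (infsum (\<lambda>y. norm (?f (x, y))) ?U)) summable_on ?U"
      by (simp add: abs_mult infsum_nonneg norm_mult)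
  qed
  then have sm: "?f summable_on ?U \<times> ?U" by (rule abs_summable_summable)
  let ?S = "Sigma ?U (\<lambda>n. {d. d dvd n})" and ?h = "\<lambda>(n, d). (n div d, d :: nat)"
  have bij: "bij_betw ?h ?S (?U \<times> ?U)"
  proof (rule bij_betwI[where g = "\<lambda>(x, y). (x * y, y)"])
    show "?h \<in> ?S \<rightarrow> ?U \<times> ?U"
      by (auto simp: Suc_le_eq div_greater_zero_iff dvd_imp_le intro: dvd_pos_nat)
  qed (auto simp: Suc_le_eq)
  have "infsum a ?U * infsum b ?U = (\<Sum>\<^sub>\<infinity>x\<in>?U. \<Sum>\<^sub>\<infinity>y\<in>?U. ?f (x, y))"
    by (simp add: infsum_cmult_left' infsum_cmult_right')
  also have "\<dots> = infsum ?f (?U \<times> ?U)"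
    by (rule infsum_Sigma_banach[OF sm])
  also have "\<dots> = infsum (\<lambda>z. ?f (?h z)) ?S"
    by (rule infsum_reindex_bij_betw[OF bij, symmetric])
  also have "\<dots> = (\<Sum>\<^sub>\<infinity>n\<in>?U. \<Sum>\<^sub>\<infinity>d\<in>{d. d dvd n}. ?f (?h (n, d)))"
    by (rule infsum_Sigma_banach[symmetric]) (use sm summable_on_reindex_bij_betw[OF bij] in blast)
  also have "\<dots> = (\<Sum>\<^sub>\<infinity>n\<in>?U. \<Sum>d | d dvd n. a (n div d) * b d)"
    by (intro infsum_cong) simp
  finally show ?thesis .
qed

lemma zeta_series_times_moebius_series:
  assumes s: "Re s > 1"
  shows "zeta_series s * (\<Sum>n. of_int (moebius (Suc n)) / of_nat (Suc n) powr s) = 1"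
proof -
  let ?a = "\<lambda>n. 1 / of_nat n powr s :: complex" and ?b = "\<lambda>n. of_int (moebius n) / of_nat n powr s :: complex"
  have sm: "summable (\<lambda>n. real (Suc n) powr (- Re s))" by (rule summable_Suc_powr[OF s])
  have a: "summable (\<lambda>n. norm (?a (Suc n)))"
    unfolding norm_divide norm_nat_powr using sm by (simp only: norm_one powr_minus_divide)
  have b: "summable (\<lambda>n. norm (?b (Suc n)))"
  proof (rule summable_comparison_test'[OF sm])
    fix n
    have "norm (of_int (moebius (Suc n)) :: complex) \<le> 1"
      using abs_moebius_le[of "Suc n"] by (simp flip: of_int_abs)
    then have "norm (?b (Suc n)) \<le> 1 / real (Suc n) powr Re s"
      unfolding norm_divide norm_nat_powr by (intro divide_right_mono) auto
    then show "norm (norm (?b (Suc n))) \<le> real (Suc n) powr (- Re s)"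
      by (simp only: powr_minus_divide real_norm_def abs_norm_cancel)
  qed
  have "zeta_series s * (\<Sum>n. ?b (Suc n)) = infsum ?a {1..} * infsum ?b {1..}"
    unfolding has_sum_shift_Suc(2)[OF a] has_sum_shift_Suc(2)[OF b] zeta_series_def ..
  also have "\<dots> = (\<Sum>\<^sub>\<infinity>n\<in>{1..}. \<Sum>d | d dvd n. ?a (n div d) * ?b d)"
    by (rule dirichlet_product[OF has_sum_shift_Suc(1)[OF a] has_sum_shift_Suc(1)[OF b]])
  also have "\<dots> = (\<Sum>\<^sub>\<infinity>n\<in>{1::nat..}. if n = 1 then 1 else 0)"
  proof (rule infsum_cong)
    fix n :: nat assume n: "n \<in> {1..}"
    have "(\<Sum>d | d dvd n. ?a (n div d) * ?b d) = (\<Sum>d | d dvd n. of_int (moebius d) / of_nat n powr s)"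
    proof (rule sum.cong)
      fix d assume "d \<in> {d. d dvd n}"
      then have "of_nat n = (of_nat (n div d) * of_nat d :: complex)"
        by (simp flip: of_nat_mult)
      then have "of_nat n powr s = (of_nat (n div d) powr s * of_nat d powr s :: complex)"
        by (simp only:) (rule powr_times_real, auto)
      then show "?a (n div d) * ?b d = of_int (moebius d) / of_nat n powr s" by simp
    qed simp
    also have "\<dots> = of_int (\<Sum>d | d dvd n. moebius d) / of_nat n powr s"
      by (simp add: sum_divide_distrib)
    also have "\<dots> = (if n = 1 then 1 else 0)"
      using sum_moebius_divisors[of n] n by simp
    finally show "(\<Sum>d | d dvd n. ?a (n div d) * ?b d) = (if n = 1 then 1 else 0)" .
  qed
  also have "\<dots> = infsum (\<lambda>n. 1) {1 :: nat}"
    by (rule infsum_cong_neutral) auto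
  finally show ?thesis by simp
qed

text \<open>Mean value inequality on the real segment from n to n + 1: the derivative of z^(-s) is
  -s z^(-s-1), bounded there by its size at n.\<close>

lemma norm_powr_minus_diff_le:
  assumes s: "Re s > 0" and n: "n > 0"
  shows "norm (of_nat n powr (- s) - of_nat (Suc n) powr (- s) :: complex) \<le> norm s * real n powr (- Re s - 1)"
proof -
  have "norm (of_nat (Suc n) powr (- s) - of_nat n powr (- s) :: complex)
      \<le> norm s * real n powr (- Re s - 1) * norm (of_nat (Suc n) - of_nat n :: complex)"
  proof (rule field_differentiable_bound[where S = "of_real ` {real n..real (Suc n)}" and f' = "\<lambda>z. (- s) * z powr (- s - 1)"])
    show "convex (complex_of_real ` {real n..real (Suc n)})"
      by (rule convex_linear_image) (auto intro: bounded_linear.linear bounded_linear_of_real)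
    fix z assume "z \<in> complex_of_real ` {real n..real (Suc n)}"
    then obtain x where x: "z = of_real x" "real n \<le> x" by auto
    have x0: "x > 0" using x n by simp
    show "((\<lambda>z. z powr (- s)) has_field_derivative (- s) * z powr (- s - 1)) (at z within complex_of_real ` {real n..real (Suc n)})"
      using x0 x by (intro has_field_derivative_at_within[OF has_field_derivative_powr]) simp
    have "norm (z powr (- s - 1)) = x powr (- Re s - 1)"
      using x x0 by (simp add: norm_powr_real_powr)
    also have "\<dots> \<le> real n powr (- Re s - 1)"
      using x n s by (intro powr_mono2') auto
    finally show "norm (- s * z powr (- s - 1)) \<le> norm s * real n powr (- Re s - 1)"
      by (simp add: norm_mult mult_left_mono)
  qed (force intro: rev_image_eqI[of "real n"] rev_image_eqI[of "real (Suc n)"])+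
  then show ?thesis by (simp add: norm_minus_commute)
qed

text \<open>The Moebius Dirichlet series after Abel summation.\<close>

definition mertens_series :: "complex \<Rightarrow> complex" where
  "mertens_series s = (\<Sum>n. of_int (mertens (real (Suc n))) * (of_nat (Suc n) powr (- s) - of_nat (Suc (Suc n)) powr (- s)))"

lemma mertens_series_eq_moebius_series:
  assumes s: "Re s > 2"
  shows "mertens_series s = (\<Sum>n. of_int (moebius (Suc n)) / of_nat (Suc n) powr s)"
proof -
  let ?u = "\<lambda>n. of_nat (Suc n) powr (- s) :: complex"
  let ?M = "\<lambda>n. of_int (mertens (real n)) :: complex"
  have part: "(\<Sum>n<N. ?M (Suc n) * (?u n - ?u (Suc n))) = (\<Sum>n<N. of_int (moebius (Suc n)) * ?u n) - ?M N * ?u N" for N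
  proof (induction N)
    case 0
    then show ?case using mertens_of_nat[of 0] by simp
  next
    case (Suc N)
    then show ?case unfolding sum.lessThan_Suc mertens_Suc by (simp add: algebra_simps)
  qed
  \<comment> \<open>The boundary term pairs M(N) with the base N + 1; the trivial bound |M(N)| <= N
    makes it at most (N+1)^(1 - Re s).\<close>
  have lim: "(\<lambda>N. ?M N * ?u N) \<longlonglongrightarrow> 0"
  proof (rule Lim_null_comparison)
    show "\<forall>\<^sub>F N in sequentially. norm (?M N * ?u N) \<le> real (Suc N) powr (1 - Re s)"
    proof (rule always_eventually, rule allI)
      fix N
      have "norm (?M N) = real_of_int \<bar>mertens (real N)\<bar>" by (simp flip: of_int_abs)
      also have "\<dots> \<le> real_of_int (int N)" by (subst of_int_le_iff) (rule abs_mertens_le)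
      also have "\<dots> \<le> real (Suc N) powr 1" by simp
      finally have "norm (?M N) * norm (?u N) \<le> real (Suc N) powr 1 * real (Suc N) powr (- Re s)"
        unfolding norm_nat_powr by (intro mult_mono) auto
      then show "norm (?M N * ?u N) \<le> real (Suc N) powr (1 - Re s)"
        by (simp only: norm_mult flip: powr_add) simp
    qed
    have "filterlim (\<lambda>N. real (Suc N)) at_top sequentially"
      using filterlim_compose[OF filterlim_real_sequentially filterlim_Suc] by simp
    then show "(\<lambda>N. real (Suc N) powr (1 - Re s)) \<longlonglongrightarrow> 0"
      using s by (intro tendsto_neg_powr) auto
  qed
  have "summable (\<lambda>n. of_int (moebius (Suc n)) * ?u n)"
  proof (rule summable_comparison_test'[OF summable_Suc_powr[of "Re s"]])
    fix n
    have "norm (of_int (moebius (Suc n)) :: complex) \<le> 1"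
      using abs_moebius_le[of "Suc n"] by (simp flip: of_int_abs)
    then have "norm (of_int (moebius (Suc n)) :: complex) * real (Suc n) powr (- Re s) \<le> 1 * real (Suc n) powr (- Re s)"
      by (rule mult_right_mono) simp
    then show "norm (of_int (moebius (Suc n)) * ?u n) \<le> real (Suc n) powr (- Re s)"
      unfolding norm_mult norm_nat_powr by simp
  qed (use s in simp)
  then have "(\<lambda>N. \<Sum>n<N. of_int (moebius (Suc n)) * ?u n) \<longlonglongrightarrow> (\<Sum>n. of_int (moebius (Suc n)) * ?u n)"
    by (rule summable_LIMSEQ)
  from tendsto_diff[OF this lim]
  have "(\<lambda>n. ?M (Suc n) * (?u n - ?u (Suc n))) sums (\<Sum>n. of_int (moebius (Suc n)) * ?u n)"
    unfolding sums_def part by simp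
  then show ?thesis
    unfolding mertens_series_def by (simp add: sums_iff powr_minus divide_inverse)
qed

lemma mertens_series_holomorphic:
  assumes bound: "\<And>\<epsilon>. \<epsilon> > 0 \<Longrightarrow> \<exists>C. \<forall>n\<ge>1. \<bar>real_of_int (mertens (real n))\<bar> \<le> C * real n powr (1 / 2 + \<epsilon>)"
  shows "mertens_series holomorphic_on {s. Re s > 1 / 2}"
proof -
  let ?G = "\<lambda>s n. of_int (mertens (real (Suc n))) * (of_nat (Suc n) powr (- s) - of_nat (Suc (Suc n)) powr (- s)) :: complex"
  have "(\<lambda>s. \<Sum>n. ?G s n) holomorphic_on {s. Re s > 1 / 2}"
  proof (rule holomorphic_on_suminf_locally)
    fix z assume "z \<in> {s. Re s > 1 / 2}"
    \<comment> \<open>A quarter of the distance to the critical line: with Re s > 1/2 + 2 epsilon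
      near z and growth exponent 1/2 + epsilon, the terms decay like n^(-1-epsilon).\<close>
    define \<epsilon> where "\<epsilon> = (Re z - 1 / 2) / 4"
    have e: "\<epsilon> > 0" "1 / 2 + 2 * \<epsilon> < Re z" using \<open>z \<in> _\<close> by (auto simp: \<epsilon>_def field_simps)
    obtain C where C: "\<And>n. n \<ge> 1 \<Longrightarrow> \<bar>real_of_int (mertens (real n))\<bar> \<le> C * real n powr (1 / 2 + \<epsilon>)"
      using bound[OF e(1)] by blast
    have C0: "C \<ge> 0" using C[of 1] by simp
    \<comment> \<open>The disc keeps the factor \<open>norm s\<close> of the difference bound under
      control.\<close>
    define R where "R = norm z + 1"
    then have R0: "R \<ge> 0" by simp
    let ?V = "{s. Re s > 1 / 2 + 2 * \<epsilon>} \<inter> ball 0 R"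
    let ?B = "\<lambda>n. C * R * real (Suc n) powr (- (1 + \<epsilon>))"
    show "\<exists>V B. open V \<and> z \<in> V \<and> summable B \<and> (\<forall>n. (\<lambda>s. ?G s n) holomorphic_on V) \<and>
        (\<forall>s\<in>V. \<forall>n. norm (?G s n) \<le> B n)"
    proof (intro exI conjI ballI allI)
      show "open ?V" by (intro open_Int open_halfspace_Re_gt open_ball)
      show "z \<in> ?V" using e by (simp add: R_def)
      show "summable ?B" using e by (intro summable_mult summable_Suc_powr) simp
      show "(\<lambda>s. ?G s n) holomorphic_on ?V" for n
        by (intro holomorphic_intros)
      fix s n assume s: "s \<in> ?V"
      have "norm (of_nat (Suc n) powr (- s) - of_nat (Suc (Suc n)) powr (- s) :: complex)
          \<le> norm s * real (Suc n) powr (- Re s - 1)"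
        by (rule norm_powr_minus_diff_le) (use s e in auto)
      also have "\<dots> \<le> R * real (Suc n) powr (- (1 / 2 + 2 * \<epsilon>) - 1)"
        using s R0 by (intro mult_mono powr_mono) auto
      finally have d: "norm (of_nat (Suc n) powr (- s) - of_nat (Suc (Suc n)) powr (- s) :: complex)
          \<le> R * real (Suc n) powr (- (1 / 2 + 2 * \<epsilon>) - 1)" .
      have "norm (of_int (mertens (real (Suc n))) :: complex) \<le> C * real (Suc n) powr (1 / 2 + \<epsilon>)"
        using C[of "Suc n"] by (simp flip: of_int_abs)
      from mult_mono[OF this d]
      have "norm (?G s n) \<le> (C * real (Suc n) powr (1 / 2 + \<epsilon>)) * (R * real (Suc n) powr (- (1 / 2 + 2 * \<epsilon>) - 1))"
        unfolding norm_mult using C0 by simp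
      also have "\<dots> = C * R * (real (Suc n) powr (1 / 2 + \<epsilon>) * real (Suc n) powr (- (1 / 2 + 2 * \<epsilon>) - 1))"
        by (simp only: mult_ac)
      also have "real (Suc n) powr (1 / 2 + \<epsilon>) * real (Suc n) powr (- (1 / 2 + 2 * \<epsilon>) - 1)
          = real (Suc n) powr ((1 / 2 + \<epsilon>) + (- (1 / 2 + 2 * \<epsilon>) - 1))"
        by (rule powr_add[symmetric])
      also have "(1 / 2 + \<epsilon>) + (- (1 / 2 + 2 * \<epsilon>) - 1) = - (1 + \<epsilon>)" by simp
      finally show "norm (?G s n) \<le> ?B n" .
    qed
  qed
  then show ?thesis by (simp add: mertens_series_def[abs_def])
qed

lemma riemann_zeta_nonzero_right:
  assumes bound: "\<And>\<epsilon>. \<epsilon> > 0 \<Longrightarrow> \<exists>C. \<forall>n\<ge>1. \<bar>real_of_int (mertens (real n))\<bar> \<le> C * real n powr (1 / 2 + \<epsilon>)"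
    and s: "Re s > 1 / 2" "s \<noteq> 1"
  shows "riemann_zeta s \<noteq> 0"
proof -
  have "riemann_zeta s * mertens_series s = 1"
  proof (rule analytic_continuation_open[where s = "{s. Re s > 2}" and s' = "{s. Re s > 1 / 2} - {1}"
        and f = "\<lambda>s. riemann_zeta s * mertens_series s" and g = "\<lambda>_. 1" and z = s])
    show "open ({s. Re s > 1 / 2} - {1 :: complex})" by (intro open_delete open_halfspace_Re_gt)
    show "connected ({s. Re s > 1 / 2} - {1 :: complex})"
      by (intro connected_open_delete open_halfspace_Re_gt convex_connected convex_halfspace_Re_gt) simp
    have "3 \<in> {s. Re s > 2}" by simp
    then show "{s. Re s > 2} \<noteq> {}" by blast
    show "(\<lambda>s. riemann_zeta s * mertens_series s) holomorphic_on {s. Re s > 1 / 2} - {1}"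
      by (intro holomorphic_on_mult holomorphic_on_subset[OF riemann_zeta_holomorphic]
          holomorphic_on_subset[OF mertens_series_holomorphic[OF bound]]) auto
    show "riemann_zeta z * mertens_series z = 1" if "z \<in> {s. Re s > 2}" for z
      using that mertens_series_eq_moebius_series[of z] riemann_zeta_eq_series[of z]
        zeta_series_times_moebius_series[of z] by simp
  qed (use s in \<open>auto intro: open_halfspace_Re_gt\<close>)
  then show ?thesis by auto
qed

section \<open>The Riemann hypothesis\<close>

text \<open>The Landau bound starts at some \<open>n0\<close>; below it |M(n)| <= n < n0 while the
  power is at least 1, whence the constant \<open>c + real n0\<close>.\<close>

lemma mertens_bound_of_spectral_bound:
  assumes e: "\<epsilon> > 0"
    and O: "(\<lambda>n. spectral_norm (map_mat real_of_int (mertens_matrix n))) \<in> O(\<lambda>n. real n powr (1 / 2 + \<epsilon>))"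
  shows "\<exists>C. \<forall>n\<ge>1. \<bar>real_of_int (mertens (real n))\<bar> \<le> C * real n powr (1 / 2 + \<epsilon>)"
proof -
  let ?N = "\<lambda>n. spectral_norm (map_mat real_of_int (mertens_matrix n))" and ?g = "\<lambda>n. real n powr (1 / 2 + \<epsilon>)"
  obtain c where c: "c > 0" "\<forall>\<^sub>F n in sequentially. norm (?N n) \<le> c * norm (?g n)"
    using landau_o.bigE[OF O] by blast
  then obtain n0 where n0: "\<And>n. n \<ge> n0 \<Longrightarrow> norm (?N n) \<le> c * norm (?g n)"
    unfolding eventually_sequentially by blast
  have "\<bar>real_of_int (mertens (real n))\<bar> \<le> (c + real n0) * ?g n" if n: "n \<ge> 1" for n
  proof (cases "n \<ge> n0")
    case True
    have "\<bar>real_of_int (mertens (real n))\<bar> \<le> norm (?N n)"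
      using abs_mertens_le_spectral_norm[OF n] by simp
    also have "\<dots> \<le> c * ?g n" using n0[OF True] by simp
    also have "\<dots> \<le> (c + real n0) * ?g n" by (rule mult_right_mono) auto
    finally show ?thesis .
  next
    case False
    have "\<bar>real_of_int (mertens (real n))\<bar> = real_of_int \<bar>mertens (real n)\<bar>" by simp
    also have "\<dots> \<le> real_of_int (int n)" by (subst of_int_le_iff) (rule abs_mertens_le)
    also have "\<dots> \<le> (c + real n0) * 1" using False c(1) by simp
    also have "\<dots> \<le> (c + real n0) * ?g n"
      using n e c(1) by (intro mult_left_mono) (auto simp: ge_one_powr_ge_zero)
    finally show ?thesis .
  qed
  then show ?thesis by blast
qed

lemma sin_half_pi_zero_cases:
  assumes "sin (of_real pi * s / 2) = (0 :: complex)" "Re s < 1" "s \<noteq> 0"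
  shows "\<exists>k::nat. s = - 2 * of_nat (Suc k)"
proof -
  obtain m :: int where m: "of_real pi * s / 2 = of_real (of_int m * pi)"
    using assms(1) by (auto simp: sin_eq_0)
  then have s: "s = 2 * of_int m" by (simp add: field_simps)
  then have "m < 1" "m \<noteq> 0" using assms by auto
  \<comment> \<open>The trivial zeros are counted from k = 0, so m = -(k+1) gives k = -m -
    1.\<close>
  then have "m = - int (Suc (nat (- m - 1)))" by simp
  then have "s = - 2 * of_nat (Suc (nat (- m - 1)))"
    using s by (metis mult_minus_left mult_minus_right of_int_minus of_int_of_nat_eq)
  then show ?thesis by blast
qed

theorem theorem1:
  assumes "\<And>\<epsilon>::real. \<epsilon> > 0 \<Longrightarrow>
    (\<lambda>n. spectral_norm (map_mat real_of_int (mertens_matrix n))) \<in> O(\<lambda>n. real n powr (1 / 2 + \<epsilon>))"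
  shows "riemann_hypothesis"
  unfolding riemann_hypothesis_def
proof (intro allI impI)
  fix s assume s: "s \<noteq> 1" "riemann_zeta s = 0"
  have bound: "\<exists>C. \<forall>n\<ge>1. \<bar>real_of_int (mertens (real n))\<bar> \<le> C * real n powr (1 / 2 + \<epsilon>)"
    if "\<epsilon> > 0" for \<epsilon> using mertens_bound_of_spectral_bound[OF that assms[OF that]] .
  have nonzero: "riemann_zeta w \<noteq> 0" if "Re w > 1 / 2" "w \<noteq> 1" for w
    using riemann_zeta_nonzero_right[OF bound that] .
  show "(\<exists>k::nat. s = - 2 * of_nat (Suc k)) \<or> Re s = 1 / 2"
  proof (cases "Re s = 1 / 2")
    case False
    then have re: "Re s < 1 / 2" using nonzero[of s] s by force
    have s0: "s \<noteq> 0" using s(2) riemann_zeta_zero by auto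
    \<comment> \<open>The reflected point lies to the right of the critical line, and s different
      from 0 keeps it away from 1.\<close>
    have "riemann_zeta (1 - s) \<noteq> 0" using re s0 by (intro nonzero) auto
    moreover have "Gamma (1 - s) \<noteq> 0"
    proof -
      have "1 - s \<notin> \<int>\<^sub>\<le>\<^sub>0" using re by (auto elim!: nonpos_Ints_cases simp: complex_eq_iff)
      then show ?thesis by (simp add: Gamma_eq_zero_iff)
    qed
    \<comment> \<open>All other factors of the functional equation are nonzero, so the sine must
      vanish.\<close>
    ultimately have "sin (of_real pi * s / 2) = 0"
      using riemann_zeta_functional_equation[of s] re s0 s(2) by simp
    then show ?thesis using sin_half_pi_zero_cases[of s] re s0 by simp
  qed simp
qed

end
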